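(* Let $(G,\mu,\alpha)$ be a Hom-algebra over $\mathbb{K}$ (possibly infinite-dimensional). Then the Sweedler duality $G^{\circ}$ of $G$ is a Hom-coalgebra $(G^{\circ},\Delta,\alpha^{\circ})$, where $\Delta=\mu^{*}|_{G^{\circ}}$ and $\alpha^{\circ}=\alpha^{*}|_{G^{\circ}}$, with $\mu^{*}:G^{*}\to (G\otimes G)^{*}$ and $\alpha^{*}:G^*\to G^*$ the dual maps of $\mu$ and $\alpha$.
   Context: $\mathbb{K}$ is a field of characteristic zero; all linear spaces and tensor products are over $\mathbb{K}$, and $V^*$ is the full linear dual of $V$. A Hom-algebra (Hom-associative algebra) is a triple $(G,\mu,\alpha)$ where $G$ is a linear space, $\mu:G\otimes G\to G$, $\mu(g\otimes g')=gg'$, is a linear map and $\alpha:G\to G$ is a linear map such that $\alpha(g)(hk)=(gh)\alpha(k)$ and $\alpha(hk)=\alpha(h)\alpha(k)$ for all $g,h,k\in G$. No unit is required. An ideal of $G$ is a subspace $H\subseteq G$ such that $\alpha(H)\subseteq H$ and $ab\in H$, $ba\in H$ for all $a\in G$, $b\in H$. It is finite-codimensional if $\dim(G/H)<\infty$. The Sweedler duality of $G$ is $G^{\circ}=\{f\in G^*\mid \operatorname{Ker} f\supseteq J \text{ for some finite-codimensional ideal } J \text{ of } G\}$. A Hom-coalgebra is a triple $(C,\Delta,\beta)$ where $C$ is a linear space and $\Delta:C\to C\otimes C$, $\beta:C\to C$ are linear maps with $(\beta\otimes\Delta)\circ\Delta=(\Delta\otimes\beta)\circ\Delta$ and $\Delta\circ\beta=(\beta\otimes\beta)\circ\Delta$.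 No counit is required. The dual maps are $\langle\mu^*(f),x\otimes y\rangle=\langle f,\mu(x\otimes y)\rangle$ and $\alpha^*(f)=f\circ\alpha$. The space $G^{\circ}\otimes G^{\circ}$ is regarded as a subspace of $(G\otimes G)^*$ via $(f\otimes g)(x\otimes y)=f(x)g(y)$; the assertion includes that $\mu^*(G^{\circ})\subseteq G^{\circ}\otimes G^{\circ}$ and $\alpha^*(G^{\circ})\subseteq G^{\circ}$. *)

theory Defs
  imports Complex_Main "HOL-Library.Function_Algebras"
begin

section \<open>Vector spaces as subspaces of an ambient type\<close>

text \<open>
  A vector space is given by a subspace \<open>vecs V\<close> of an ambient space, which is an additive group
  type with a scalar multiplication \<open>scl V\<close>. Any vector space arises in this way, with
  \<open>vecs V = UNIV\<close>; the freedom in the carrier is needed for duals, tensor products and the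
  Sweedler dual.
\<close>

record ('k, 'v) vs =
  vecs :: "'v set"
  scl :: "'k \<Rightarrow> 'v \<Rightarrow> 'v"

definition vspace :: "('k::field, 'v::ab_group_add) vs \<Rightarrow> bool" where
  "vspace V \<longleftrightarrow> vector_space (scl V) \<and> module.subspace (scl V) (vecs V)"

definition ground :: "('k::field, 'k) vs" where
  "ground = \<lparr>vecs = UNIV, scl = (*)\<rparr>"

definition fscale :: "'k::field \<Rightarrow> ('x \<Rightarrow> 'k) \<Rightarrow> 'x \<Rightarrow> 'k" where
  "fscale c f = (\<lambda>x. c * f x)"

lemma vector_space_fscale: "vector_space (fscale :: 'k::field \<Rightarrow> ('x \<Rightarrow> 'k) \<Rightarrow> 'x \<Rightarrow> 'k)"
  by unfold_locales (auto simp: fscale_def fun_eq_iff algebra_simps)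

text \<open>Maps are only constrained on the carrier of their source.\<close>

definition linear_map ::
  "('k::field, 'v::ab_group_add) vs \<Rightarrow> ('k, 'w::ab_group_add) vs \<Rightarrow> ('v \<Rightarrow> 'w) \<Rightarrow> bool" where
  "linear_map V W f \<longleftrightarrow>
     f ` vecs V \<subseteq> vecs W \<and>
     (\<forall>x\<in>vecs V. \<forall>y\<in>vecs V. f (x + y) = f x + f y) \<and>
     (\<forall>c. \<forall>x\<in>vecs V. f (scl V c x) = scl W c (f x))"

definition bilinear_map ::
  "('k::field, 'v::ab_group_add) vs \<Rightarrow> ('k, 'w::ab_group_add) vs \<Rightarrow> ('k, 'x::ab_group_add) vs
    \<Rightarrow> ('v \<Rightarrow> 'w \<Rightarrow> 'x) \<Rightarrow> bool" where
  "bilinear_map V W X b \<longleftrightarrow>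
     (\<forall>v\<in>vecs V. linear_map W X (b v)) \<and> (\<forall>w\<in>vecs W. linear_map V X (\<lambda>v. b v w))"

text \<open>Functionals on \<open>V\<close> are extended by zero outside \<open>vecs V\<close>, to have unique representatives.\<close>

definition dual :: "('k::field, 'v::ab_group_add) vs \<Rightarrow> ('k, 'v \<Rightarrow> 'k) vs" where
  "dual V = \<lparr>vecs = {f. linear_map V ground f \<and> (\<forall>x. x \<notin> vecs V \<longrightarrow> f x = 0)}, scl = fscale\<rparr>"

definition dual_map :: "('k::field, 'v::ab_group_add) vs \<Rightarrow> ('v \<Rightarrow> 'w) \<Rightarrow> ('w \<Rightarrow> 'k) \<Rightarrow> 'v \<Rightarrow> 'k" where
  "dual_map V \<phi> f = (\<lambda>x. if x \<in> vecs V then f (\<phi> x) else 0)"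


section \<open>Tensor products\<close>

text \<open>
  Over a field, \<open>V \<otimes> W\<close> embeds into the dual of the space of bilinear forms on \<open>V \<times> W\<close>, the
  tensor \<open>v \<otimes> w\<close> being the evaluation \<open>b \<mapsto> b v w\<close>; the tensor product is taken to be the span of
  these evaluations. The lemmas \<open>bilinear_map_pure_tensor\<close>, \<open>tensor_universal\<close> and
  \<open>tensor_linear_unique\<close> below give its universal property, which determines it up to unique
  isomorphism. On functions that are not bilinear forms, tensors take the irrelevant value 0.
\<close>

definition pure_tensor ::
  "('k::field, 'v::ab_group_add) vs \<Rightarrow> ('k, 'w::ab_group_add) vs \<Rightarrow> 'v \<Rightarrow> 'w
    \<Rightarrow> ('v \<Rightarrow> 'w \<Rightarrow> 'k) \<Rightarrow> 'k" where
  "pure_tensor V W v w = (\<lambda>b. if bilinear_map V W ground b then b v w else 0)"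

definition tensor ::
  "('k::field, 'v::ab_group_add) vs \<Rightarrow> ('k, 'w::ab_group_add) vs
    \<Rightarrow> ('k, ('v \<Rightarrow> 'w \<Rightarrow> 'k) \<Rightarrow> 'k) vs" where
  "tensor V W =
     \<lparr>vecs = module.span fscale {pure_tensor V W v w | v w. v \<in> vecs V \<and> w \<in> vecs W},
      scl = fscale\<rparr>"

lemma tensor_simps [simp]: "scl (tensor V W) = fscale" "scl ground = (*)" "vecs ground = UNIV"
  by (simp_all add: tensor_def ground_def)

lemma module_fscale: "module (fscale :: 'k::field \<Rightarrow> ('x \<Rightarrow> 'k) \<Rightarrow> 'x \<Rightarrow> 'k)"
  using vector_space_fscale by (simp add: module_iff_vector_space)

lemma vspace_tensor: "vspace (tensor V W)"
  unfolding vspace_def tensor_def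
  by (simp add: vector_space_fscale module.subspace_span[OF module_fscale])

lemma pure_tensor_in:
  "v \<in> vecs V \<Longrightarrow> w \<in> vecs W \<Longrightarrow> pure_tensor V W v w \<in> vecs (tensor V W)"
  unfolding tensor_def by (auto intro!: module.span_base[OF module_fscale])

lemma tensor_add: "s \<in> vecs (tensor V W) \<Longrightarrow> t \<in> vecs (tensor V W) \<Longrightarrow> s + t \<in> vecs (tensor V W)"
  unfolding tensor_def by (simp add: module.span_add[OF module_fscale])

lemma tensor_scale: "t \<in> vecs (tensor V W) \<Longrightarrow> fscale c t \<in> vecs (tensor V W)"
  unfolding tensor_def by (simp add: module.span_scale[OF module_fscale])

lemma zero_in_tensor: "0 \<in> vecs (tensor V W)"
  unfolding tensor_def by (simp add: module.span_zero[OF module_fscale] del: zero_fun_apply)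

lemma tensor_induct [consumes 1, case_names zero step]:
  assumes "t \<in> vecs (tensor V W)" "P 0"
    and "\<And>c v w t. v \<in> vecs V \<Longrightarrow> w \<in> vecs W \<Longrightarrow> t \<in> vecs (tensor V W) \<Longrightarrow> P t
      \<Longrightarrow> P (fscale c (pure_tensor V W v w) + t)"
  shows "P t"
proof -
  have "t \<in> module.span fscale {pure_tensor V W v w | v w. v \<in> vecs V \<and> w \<in> vecs W}"
    using assms(1) by (simp add: tensor_def)
  then have "t \<in> vecs (tensor V W) \<and> P t"
  proof (induction rule: module.span_induct_alt[OF module_fscale, consumes 1])
    case 1
    show ?case using assms(2) zero_in_tensor by blast
  next
    case (2 c x y)
    then show ?case
      using assms(3) by (blast intro: tensor_add tensor_scale pure_tensor_in)
  qed
  then show ?thesis ..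
qed

lemma bilinear_map_pure_tensor:
  "vspace V \<Longrightarrow> vspace W \<Longrightarrow> bilinear_map V W (tensor V W) (pure_tensor V W)"
  unfolding bilinear_map_def linear_map_def
  by (auto simp: pure_tensor_in)
    (auto simp: pure_tensor_def fscale_def fun_eq_iff bilinear_map_def linear_map_def)

lemma linear_separates:
  assumes X: "vector_space sX" and ne: "(x::'x::ab_group_add) \<noteq> 0"
  obtains \<phi> where "Vector_Spaces.linear sX ((*) :: 'k::field \<Rightarrow> _) \<phi>" "\<phi> x \<noteq> 0"
proof -
  interpret X: vector_space sX by fact
  interpret K: vector_space "(*) :: 'k \<Rightarrow> _" by unfold_locales (auto simp: algebra_simps)
  interpret P: vector_space_pair sX "(*) :: 'k \<Rightarrow> _" ..
  have "X.independent {x}" using ne by (simp add: X.dependent_single)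
  then show ?thesis
    using that[of "P.construct {x} (\<lambda>_. 1)"] P.linear_construct P.construct_basis by force
qed

theorem tensor_universal:
  fixes V :: "('k::field, 'v::ab_group_add) vs" and W :: "('k, 'w::ab_group_add) vs"
    and X :: "('k, 'x::ab_group_add) vs"
  assumes X: "vspace X" and h: "bilinear_map V W X h"
  shows "\<exists>L. linear_map (tensor V W) X L \<and>
    (\<forall>v\<in>vecs V. \<forall>w\<in>vecs W. L (pure_tensor V W v w) = h v w)"
proof -
  let ?f = "fscale :: 'k \<Rightarrow> (('v \<Rightarrow> 'w \<Rightarrow> 'k) \<Rightarrow> 'k) \<Rightarrow> _"
  let ?S = "{pure_tensor V W v w | v w. v \<in> vecs V \<and> w \<in> vecs W}"
  interpret X: vector_space "scl X" using X by (simp add: vspace_def)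
  interpret F: vector_space ?f by (rule vector_space_fscale)
  interpret P: vector_space_pair ?f "scl X" ..
  obtain B where B: "B \<subseteq> ?S" "F.independent B" "?S \<subseteq> F.span B"
    using F.maximal_independent_subset by blast
  have "\<forall>b\<in>B. \<exists>p. fst p \<in> vecs V \<and> snd p \<in> vecs W \<and> b = pure_tensor V W (fst p) (snd p)"
    using B(1) by fastforce
  then obtain p where p: "\<And>b. b \<in> B \<Longrightarrow> fst (p b) \<in> vecs V \<and> snd (p b) \<in> vecs W \<and>
      b = pure_tensor V W (fst (p b)) (snd (p b))"
    by metis
  define L where "L = P.construct B (\<lambda>b. h (fst (p b)) (snd (p b)))"
  interpret L: Vector_Spaces.linear ?f "scl X" L
    unfolding L_def by (rule P.linear_construct[OF B(2)])
  have L: "L b = h (fst (p b)) (snd (p b))" if "b \<in> B" for b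
    unfolding L_def using P.construct_basis[OF B(2) that] .
  have eq: "L (pure_tensor V W v w) = h v w" if vw: "v \<in> vecs V" "w \<in> vecs W" for v w
  proof (rule ccontr)
    assume "L (pure_tensor V W v w) \<noteq> h v w"
    then have "L (pure_tensor V W v w) - h v w \<noteq> 0" by simp
    then obtain \<phi> where \<phi>: "Vector_Spaces.linear (scl X) (*) \<phi>"
        "\<phi> (L (pure_tensor V W v w) - h v w) \<noteq> 0"
      using linear_separates[OF X.vector_space_axioms] by blast
    interpret \<phi>: Vector_Spaces.linear "scl X" "(*)" \<phi> by fact
    have bil: "bilinear_map V W ground (\<lambda>v w. \<phi> (h v w))"
      using h by (auto simp: bilinear_map_def linear_map_def \<phi>.add \<phi>.scale)
    have ev: "Vector_Spaces.linear ?f (*) (\<lambda>t. t (\<lambda>v w. \<phi> (h v w)))"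
      by unfold_locales (auto simp: fscale_def algebra_simps)
    have \<phi>L: "Vector_Spaces.linear ?f (*) (\<lambda>t. \<phi> (L t))"
      using Vector_Spaces.linear_compose[OF L.linear_axioms \<phi>(1)] by (simp add: o_def)
    interpret Q: vector_space_pair ?f "(*)" using ev by (simp add: Vector_Spaces.linear_def vector_space_pair_def)
    have "pure_tensor V W v w \<in> F.span B" using B(3) vw by blast
    then have "\<phi> (L (pure_tensor V W v w)) = pure_tensor V W v w (\<lambda>v w. \<phi> (h v w))"
    proof (rule Q.linear_eq_on[OF \<phi>L ev])
      fix b assume b: "b \<in> B"
      have "b (\<lambda>v w. \<phi> (h v w)) = \<phi> (h (fst (p b)) (snd (p b)))"
        using p[OF b] bil by (metis (no_types, lifting) pure_tensor_def)
      then show "\<phi> (L b) = b (\<lambda>v w. \<phi> (h v w))" using L[OF b] by simp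
    qed
    then show False using \<phi>(2) bil by (simp add: \<phi>.diff pure_tensor_def)
  qed
  have "L t \<in> vecs X" if "t \<in> vecs (tensor V W)" for t
    using that
  proof (induction rule: tensor_induct)
    case zero
    then show ?case using X by (metis L.zero X.subspace_0 vspace_def)
  next
    case (step c v w t)
    then have "h v w \<in> vecs X" using h unfolding bilinear_map_def linear_map_def by blast
    with step show ?case using X eq
      by (simp add: L.add L.scale vspace_def X.subspace_add X.subspace_scale del: plus_fun_apply)
  qed
  then have "linear_map (tensor V W) X L"
    by (auto simp: linear_map_def L.add L.scale)
  with eq show ?thesis by blast
qed

theorem tensor_linear_unique:
  assumes "linear_map (tensor V W) X L" "linear_map (tensor V W) X L'"
    and "\<And>v w. v \<in> vecs V \<Longrightarrow> w \<in> vecs W \<Longrightarrow> L (pure_tensor V W v w) = L' (pure_tensor V W v w)"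
    and "t \<in> vecs (tensor V W)"
  shows "L t = L' t"
  using assms(4)
proof (induction rule: tensor_induct)
  case zero
  have "M 0 = 0" if "linear_map (tensor V W) X M" for M
  proof -
    have "M (0 + 0) = M 0 + M 0" using that zero_in_tensor unfolding linear_map_def by blast
    then show ?thesis by (metis add_cancel_right_right)
  qed
  then show ?case using assms(1,2) by metis
next
  case (step c v w t)
  have "M (fscale c (pure_tensor V W v w) + t) = scl X c (M (pure_tensor V W v w)) + M t"
    if "linear_map (tensor V W) X M" for M
    using that step.hyps unfolding linear_map_def
    by (metis pure_tensor_in tensor_scale tensor_simps(1))
  then show ?case using assms(1-3) step by metis
qed

lemma tensor_form_add:
  assumes "t \<in> vecs (tensor V W)" "bilinear_map V W ground b" "bilinear_map V W ground b'"
    and "\<And>v w. v \<in> vecs V \<Longrightarrow> w \<in> vecs W \<Longrightarrow> b'' v w = b v w + b' v w"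
    and "bilinear_map V W ground b''"
  shows "t b'' = t b + t b'"
  using assms(1)
  by (induction rule: tensor_induct) (use assms in \<open>auto simp: fscale_def pure_tensor_def algebra_simps\<close>)

lemma tensor_form_scale:
  assumes "t \<in> vecs (tensor V W)" "bilinear_map V W ground b"
    and "\<And>v w. v \<in> vecs V \<Longrightarrow> w \<in> vecs W \<Longrightarrow> b'' v w = c * b v w"
    and "bilinear_map V W ground b''"
  shows "t b'' = c * t b"
  using assms(1)
  by (induction rule: tensor_induct) (use assms in \<open>auto simp: fscale_def pure_tensor_def algebra_simps\<close>)

lemma bilinear_map_comp:
  assumes "linear_map V V' f" "linear_map W W' g" "bilinear_map V' W' X b"
  shows "bilinear_map V W X (\<lambda>v w. b (f v) (g w))"
  using assms unfolding bilinear_map_def linear_map_def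
  by (auto simp: image_subset_iff)

text \<open>
  The map \<open>f \<otimes> g\<close> into \<open>V' \<otimes> W'\<close>: on \<open>v \<otimes> w\<close> it evaluates \<open>b\<close> at \<open>(f v, g w)\<close>, see
  \<open>tensor_map_pure\<close>.
\<close>

definition tensor_map ::
  "('k::field, 'a::ab_group_add) vs \<Rightarrow> ('k, 'b::ab_group_add) vs
    \<Rightarrow> ('v \<Rightarrow> 'a) \<Rightarrow> ('w \<Rightarrow> 'b)
    \<Rightarrow> (('v \<Rightarrow> 'w \<Rightarrow> 'k) \<Rightarrow> 'k) \<Rightarrow> ('a \<Rightarrow> 'b \<Rightarrow> 'k) \<Rightarrow> 'k" where
  "tensor_map V' W' f g t =
     (\<lambda>b. if bilinear_map V' W' ground b then t (\<lambda>v w. b (f v) (g w)) else 0)"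

lemma tensor_map_pure:
  assumes "linear_map V V' f" "linear_map W W' g"
  shows "tensor_map V' W' f g (pure_tensor V W v w) = pure_tensor V' W' (f v) (g w)"
  using bilinear_map_comp[OF assms] by (auto simp: tensor_map_def pure_tensor_def fun_eq_iff)

lemma linear_map_tensor_map:
  assumes "linear_map V V' f" "linear_map W W' g"
  shows "linear_map (tensor V W) (tensor V' W') (tensor_map V' W' f g)"
proof -
  have add: "tensor_map V' W' f g (s + t) = tensor_map V' W' f g s + tensor_map V' W' f g t" for s t
    by (auto simp: tensor_map_def fun_eq_iff)
  have scale: "tensor_map V' W' f g (fscale c t) = fscale c (tensor_map V' W' f g t)" for c t
    by (auto simp: tensor_map_def fscale_def fun_eq_iff)
  have "tensor_map V' W' f g t \<in> vecs (tensor V' W')" if "t \<in> vecs (tensor V W)" for t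
    using that
  proof (induction rule: tensor_induct)
    case zero
    have "tensor_map V' W' f g 0 = 0" by (auto simp: tensor_map_def fun_eq_iff)
    then show ?case by (metis zero_in_tensor)
  next
    case (step c v w t)
    have "f v \<in> vecs V'" "g w \<in> vecs W'" using assms step by (auto simp: linear_map_def)
    with step show ?case
      by (simp add: add scale tensor_map_pure[OF assms] tensor_add tensor_scale pure_tensor_in
          del: plus_fun_apply)
  qed
  with add scale show ?thesis by (auto simp: linear_map_def)
qed

text \<open>
  The associator from \<open>(U \<otimes> V) \<otimes> W\<close> to \<open>U \<otimes> (V \<otimes> W)\<close>, see \<open>tensor_assoc_pure\<close>.
\<close>

definition tensor_assoc ::
  "('k::field, 'u::ab_group_add) vs \<Rightarrow> ('k, 'v::ab_group_add) vs \<Rightarrow> ('k, 'w::ab_group_add) vs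
    \<Rightarrow> (((('u \<Rightarrow> 'v \<Rightarrow> 'k) \<Rightarrow> 'k) \<Rightarrow> 'w \<Rightarrow> 'k) \<Rightarrow> 'k)
    \<Rightarrow> ('u \<Rightarrow> (('v \<Rightarrow> 'w \<Rightarrow> 'k) \<Rightarrow> 'k) \<Rightarrow> 'k) \<Rightarrow> 'k" where
  "tensor_assoc U V W t =
     (\<lambda>b. if bilinear_map U (tensor V W) ground b
          then t (\<lambda>s w. s (\<lambda>u v. b u (pure_tensor V W v w))) else 0)"

lemma bilinear_map_assoc_form:
  assumes "vspace V" "vspace W" "bilinear_map U (tensor V W) ground b"
  shows "w \<in> vecs W \<Longrightarrow> bilinear_map U V ground (\<lambda>u v. b u (pure_tensor V W v w))"
    and "bilinear_map (tensor U V) W ground (\<lambda>s w. s (\<lambda>u v. b u (pure_tensor V W v w)))"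
proof -
  note p = bilinear_map_pure_tensor[OF assms(1,2)]
  have 1: "bilinear_map U V ground (\<lambda>u v. b u (pure_tensor V W v w))" if "w \<in> vecs W" for w
    using assms(3) p that unfolding bilinear_map_def linear_map_def
    by (simp add: pure_tensor_in)
  then show "w \<in> vecs W \<Longrightarrow> bilinear_map U V ground (\<lambda>u v. b u (pure_tensor V W v w))" .
  have W: "w + w' \<in> vecs W" "scl W c w \<in> vecs W" if "w \<in> vecs W" "w' \<in> vecs W" for w w' c
    using assms(2) that
    by (auto simp: vspace_def module_iff_vector_space[symmetric] module.subspace_def)
  have add: "b u (pure_tensor V W v (w + w')) = b u (pure_tensor V W v w) + b u (pure_tensor V W v w')"
    if "u \<in> vecs U" "v \<in> vecs V" "w \<in> vecs W" "w' \<in> vecs W" for u v w w'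
    using assms(3) p that unfolding bilinear_map_def linear_map_def by (simp add: pure_tensor_in)
  have scale: "b u (pure_tensor V W v (scl W c w)) = c * b u (pure_tensor V W v w)"
    if "u \<in> vecs U" "v \<in> vecs V" "w \<in> vecs W" for u v w c
    using assms(3) p that unfolding bilinear_map_def linear_map_def by (simp add: pure_tensor_in)
  show "bilinear_map (tensor U V) W ground (\<lambda>s w. s (\<lambda>u v. b u (pure_tensor V W v w)))"
    unfolding bilinear_map_def[of "tensor U V"] linear_map_def
  proof (intro conjI ballI allI)
    fix s w w' c assume s: "s \<in> vecs (tensor U V)" and w: "w \<in> vecs W" and w': "w' \<in> vecs W"
    show "s (\<lambda>u v. b u (pure_tensor V W v (w + w'))) =
        s (\<lambda>u v. b u (pure_tensor V W v w)) + s (\<lambda>u v. b u (pure_tensor V W v w'))"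
      by (rule tensor_form_add[OF s 1[OF w] 1[OF w'] _ 1[OF W(1)[OF w w']]]) (rule add[OF _ _ w w'])
  next
    fix s w c assume s: "s \<in> vecs (tensor U V)" and w: "w \<in> vecs W"
    show "s (\<lambda>u v. b u (pure_tensor V W v (scl W c w))) =
        scl ground c (s (\<lambda>u v. b u (pure_tensor V W v w)))"
      unfolding tensor_simps
      by (rule tensor_form_scale[OF s 1[OF w] _ 1[OF W(2)[OF w w]]]) (rule scale[OF _ _ w])
  qed (auto simp: fscale_def)
qed

lemma tensor_assoc_pure:
  assumes "vspace V" "vspace W" "w \<in> vecs W"
  shows "tensor_assoc U V W (pure_tensor (tensor U V) W (pure_tensor U V u v) w) =
    pure_tensor U (tensor V W) u (pure_tensor V W v w)"
proof
  fix b
  show "tensor_assoc U V W (pure_tensor (tensor U V) W (pure_tensor U V u v) w) b =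
    pure_tensor U (tensor V W) u (pure_tensor V W v w) b"
  proof (cases "bilinear_map U (tensor V W) ground b")
    case True
    note f = bilinear_map_assoc_form[OF assms(1,2) True]
    show ?thesis
      using True f(2) f(1)[OF assms(3)]
      by (simp add: tensor_assoc_def pure_tensor_def[of "tensor U V" W] pure_tensor_def[of U V]
          pure_tensor_def[of U "tensor V W"])
  qed (simp add: tensor_assoc_def pure_tensor_def[of U "tensor V W"])
qed

lemma linear_map_tensor_assoc:
  assumes "vspace V" "vspace W"
  shows "linear_map (tensor (tensor U V) W) (tensor U (tensor V W)) (tensor_assoc U V W)"
proof -
  let ?a = "tensor_assoc U V W" and ?T = "tensor U (tensor V W)"
  have add: "?a (s + t) = ?a s + ?a t" for s t
    by (auto simp: tensor_assoc_def fun_eq_iff)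
  have scale: "?a (fscale c t) = fscale c (?a t)" for c t
    by (auto simp: tensor_assoc_def fscale_def fun_eq_iff)
  have a0: "?a 0 = 0" by (auto simp: tensor_assoc_def fun_eq_iff)
  have pure: "?a (pure_tensor (tensor U V) W s w) \<in> vecs ?T"
    if "s \<in> vecs (tensor U V)" "w \<in> vecs W" for s w
    using that(1)
  proof (induction rule: tensor_induct)
    case zero
    have "pure_tensor (tensor U V) W 0 w = 0"
      using bilinear_map_pure_tensor[OF vspace_tensor assms(2), of U V] that(2)
      by (auto simp: pure_tensor_def fun_eq_iff bilinear_map_def linear_map_def)
        (metis add_cancel_right_left tensor_scale that(1) module.scale_zero_left[OF module_fscale])
    then show ?case by (metis a0 zero_in_tensor)
  next
    case (step c u v t)
    have "pure_tensor (tensor U V) W (fscale c (pure_tensor U V u v) + t) w =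
        fscale c (pure_tensor (tensor U V) W (pure_tensor U V u v) w) + pure_tensor (tensor U V) W t w"
      using bilinear_map_pure_tensor[OF vspace_tensor assms(2), of U V] that(2) step.hyps
      unfolding bilinear_map_def linear_map_def by (simp add: pure_tensor_in tensor_scale)
    with step show ?case
      by (simp add: add scale tensor_assoc_pure[OF assms that(2)] tensor_add tensor_scale
          pure_tensor_in that(2) del: plus_fun_apply)
  qed
  have "?a t \<in> vecs ?T" if "t \<in> vecs (tensor (tensor U V) W)" for t
    using that
    by (induction rule: tensor_induct) (simp_all add: a0 zero_in_tensor add scale tensor_add tensor_scale pure
        del: zero_fun_apply plus_fun_apply)
  with add scale show ?thesis by (auto simp: linear_map_def)
qed

text \<open>
  For spaces \<open>F\<close>, \<open>F'\<close> of functionals on \<open>V\<close> and \<open>W\<close>, the canonical map from \<open>F \<otimes> F'\<close> to the dual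
  of \<open>V \<otimes> W\<close> that sends \<open>f \<otimes> g\<close> to the functional \<open>x \<otimes> y \<mapsto> f x * g y\<close>, see
  \<open>tensor_to_dual_pure\<close>.
\<close>

definition tensor_to_dual ::
  "('k::field, 'v::ab_group_add) vs \<Rightarrow> ('k, 'w::ab_group_add) vs
    \<Rightarrow> ((('v \<Rightarrow> 'k) \<Rightarrow> ('w \<Rightarrow> 'k) \<Rightarrow> 'k) \<Rightarrow> 'k)
    \<Rightarrow> (('v \<Rightarrow> 'w \<Rightarrow> 'k) \<Rightarrow> 'k) \<Rightarrow> 'k" where
  "tensor_to_dual V W t =
     (\<lambda>s. if s \<in> vecs (tensor V W) then t (\<lambda>f g. s (\<lambda>x y. f x * g y)) else 0)"

lemma bilinear_map_product_form:
  assumes "f \<in> vecs (dual V)" "g \<in> vecs (dual W)"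
  shows "bilinear_map V W ground (\<lambda>x y. f x * g y)"
proof -
  have "linear_map V ground f" "linear_map W ground g" using assms by (auto simp: dual_def)
  then show ?thesis unfolding bilinear_map_def linear_map_def by (simp add: algebra_simps)
qed

lemma bilinear_map_pairing_form:
  assumes F: "vspace F" "vecs F \<subseteq> vecs (dual V)" "scl F = fscale"
    and F': "vspace F'" "vecs F' \<subseteq> vecs (dual W)" "scl F' = fscale"
    and s: "s \<in> vecs (tensor V W)"
  shows "bilinear_map F F' ground (\<lambda>f g. s (\<lambda>x y. f x * g y))"
proof -
  note b = bilinear_map_product_form[OF subsetD[OF F(2)] subsetD[OF F'(2)]]
  have cl: "f + f' \<in> vecs F" "fscale c f \<in> vecs F" if "f \<in> vecs F" "f' \<in> vecs F" for f f' c
    using F that by (metis module.subspace_add module_fscale vspace_def,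
        metis module.subspace_scale module_fscale vspace_def)
  have cl': "g + g' \<in> vecs F'" "fscale c g \<in> vecs F'" if "g \<in> vecs F'" "g' \<in> vecs F'" for g g' c
    using F' that by (metis module.subspace_add module_fscale vspace_def,
        metis module.subspace_scale module_fscale vspace_def)
  have 1: "linear_map F' ground (\<lambda>g. s (\<lambda>x y. f x * g y))" if f: "f \<in> vecs F" for f
    unfolding linear_map_def tensor_simps F'(3)
  proof (intro conjI ballI allI)
    fix g g' c assume g: "g \<in> vecs F'" and g': "g' \<in> vecs F'"
    show "s (\<lambda>x y. f x * (g + g') y) = s (\<lambda>x y. f x * g y) + s (\<lambda>x y. f x * g' y)"
      by (rule tensor_form_add[OF s b[OF f g] b[OF f g'] _ b[OF f cl'(1)[OF g g']]])
        (simp add: algebra_simps)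
  next
    fix c g assume g: "g \<in> vecs F'"
    show "s (\<lambda>x y. f x * fscale c g y) = c * s (\<lambda>x y. f x * g y)"
      by (rule tensor_form_scale[OF s b[OF f g] _ b[OF f cl'(2)[OF g g]]]) (simp add: fscale_def)
  qed simp
  have 2: "linear_map F ground (\<lambda>f. s (\<lambda>x y. f x * g y))" if g: "g \<in> vecs F'" for g
    unfolding linear_map_def tensor_simps F(3)
  proof (intro conjI ballI allI)
    fix f f' c assume f: "f \<in> vecs F" and f': "f' \<in> vecs F"
    show "s (\<lambda>x y. (f + f') x * g y) = s (\<lambda>x y. f x * g y) + s (\<lambda>x y. f' x * g y)"
      by (rule tensor_form_add[OF s b[OF f g] b[OF f' g] _ b[OF cl(1)[OF f f'] g]])
        (simp add: algebra_simps)
  next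
    fix c f assume f: "f \<in> vecs F"
    show "s (\<lambda>x y. fscale c f x * g y) = c * s (\<lambda>x y. f x * g y)"
      by (rule tensor_form_scale[OF s b[OF f g] _ b[OF cl(2)[OF f f] g]]) (simp add: fscale_def)
  qed simp
  from 1 2 show ?thesis by (simp add: bilinear_map_def)
qed

lemma tensor_to_dual_pure:
  assumes F: "vspace F" "vecs F \<subseteq> vecs (dual V)" "scl F = fscale"
    and F': "vspace F'" "vecs F' \<subseteq> vecs (dual W)" "scl F' = fscale"
    and "f \<in> vecs F" "g \<in> vecs F'" "x \<in> vecs V" "y \<in> vecs W"
  shows "tensor_to_dual V W (pure_tensor F F' f g) (pure_tensor V W x y) = f x * g y"
proof -
  have xy: "pure_tensor V W x y \<in> vecs (tensor V W)" using assms by (simp add: pure_tensor_in)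
  have fg: "bilinear_map V W ground (\<lambda>x y. f x * g y)"
    using assms by (blast intro: bilinear_map_product_form)
  have "tensor_to_dual V W (pure_tensor F F' f g) (pure_tensor V W x y) =
      pure_tensor V W x y (\<lambda>x y. f x * g y)"
    using xy bilinear_map_pairing_form[OF F F' xy]
    by (simp add: tensor_to_dual_def pure_tensor_def[of F F'])
  then show ?thesis using fg by (simp add: pure_tensor_def)
qed

lemma linear_map_tensor_to_dual:
  assumes F: "vspace F" "vecs F \<subseteq> vecs (dual V)" "scl F = fscale"
    and F': "vspace F'" "vecs F' \<subseteq> vecs (dual W)" "scl F' = fscale"
  shows "linear_map (tensor F F') (dual (tensor V W)) (tensor_to_dual V W)"
proof -
  let ?\<iota> = "tensor_to_dual V W" and ?D = "dual (tensor V W)"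
  have add: "?\<iota> (s + t) = ?\<iota> s + ?\<iota> t" for s t
    by (auto simp: tensor_to_dual_def fun_eq_iff)
  have scale: "?\<iota> (fscale c t) = fscale c (?\<iota> t)" for c t
    by (auto simp: tensor_to_dual_def fscale_def fun_eq_iff)
  have "?\<iota> t \<in> vecs ?D" if "t \<in> vecs (tensor F F')" for t
    using that
  proof (induction rule: tensor_induct)
    case zero
    have "?\<iota> 0 = 0" by (auto simp: tensor_to_dual_def fun_eq_iff)
    moreover have "0 \<in> vecs ?D" by (auto simp: dual_def linear_map_def)
    ultimately show ?case by metis
  next
    case (step c f g t)
    have "?\<iota> (pure_tensor F F' f g) \<in> vecs ?D"
    proof -
      have "?\<iota> (pure_tensor F F' f g) s = (if s \<in> vecs (tensor V W) then s (\<lambda>x y. f x * g y) else 0)" for s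
        using bilinear_map_pairing_form[OF F F'] by (auto simp: tensor_to_dual_def pure_tensor_def)
      then show ?thesis
        by (auto simp: dual_def linear_map_def tensor_add tensor_scale simp del: plus_fun_apply)
          (auto simp: fscale_def)
    qed
    moreover have "\<phi> + \<psi> \<in> vecs ?D" "fscale c \<phi> \<in> vecs ?D" if "\<phi> \<in> vecs ?D" "\<psi> \<in> vecs ?D" for \<phi> \<psi>
      using that by (auto simp: dual_def linear_map_def fscale_def algebra_simps)
    ultimately show ?case using step by (metis add scale)
  qed
  with add scale show ?thesis by (auto simp: linear_map_def dual_def)
qed


section \<open>Hom-algebras and Hom-coalgebras\<close>

definition hom_algebra ::
  "('k::field, 'g::ab_group_add) vs \<Rightarrow> ((('g \<Rightarrow> 'g \<Rightarrow> 'k) \<Rightarrow> 'k) \<Rightarrow> 'g) \<Rightarrow> ('g \<Rightarrow> 'g) \<Rightarrow> bool" where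
  "hom_algebra G \<mu> \<alpha> \<longleftrightarrow>
     vspace G \<and> linear_map (tensor G G) G \<mu> \<and> linear_map G G \<alpha> \<and>
     (let m = (\<lambda>g h. \<mu> (pure_tensor G G g h)) in
        (\<forall>g\<in>vecs G. \<forall>h\<in>vecs G. \<forall>k\<in>vecs G. m (\<alpha> g) (m h k) = m (m g h) (\<alpha> k)) \<and>
        (\<forall>h\<in>vecs G. \<forall>k\<in>vecs G. \<alpha> (m h k) = m (\<alpha> h) (\<alpha> k)))"

definition hom_ideal ::
  "('k::field, 'g::ab_group_add) vs \<Rightarrow> ((('g \<Rightarrow> 'g \<Rightarrow> 'k) \<Rightarrow> 'k) \<Rightarrow> 'g) \<Rightarrow> ('g \<Rightarrow> 'g) \<Rightarrow> 'g set \<Rightarrow> bool"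
  where
  "hom_ideal G \<mu> \<alpha> H \<longleftrightarrow>
     H \<subseteq> vecs G \<and> module.subspace (scl G) H \<and> \<alpha> ` H \<subseteq> H \<and>
     (\<forall>a\<in>vecs G. \<forall>b\<in>H. \<mu> (pure_tensor G G a b) \<in> H \<and> \<mu> (pure_tensor G G b a) \<in> H)"

text \<open>
  The quotient \<open>G/H\<close> is the set of classes modulo \<open>H\<close>; it has finite dimension iff it is spanned by
  the classes of the elements of a finite set \<open>B\<close>, i.e. iff the projection of \<open>span B\<close> is all of it.
\<close>

definition coset_rel :: "('k, 'g::ab_group_add) vs \<Rightarrow> 'g set \<Rightarrow> ('g \<times> 'g) set" where
  "coset_rel G H = {(x, y). x \<in> vecs G \<and> y \<in> vecs G \<and> x - y \<in> H}"

definition finite_codim :: "('k::field, 'g::ab_group_add) vs \<Rightarrow> 'g set \<Rightarrow> bool" where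
  "finite_codim G H \<longleftrightarrow>
     (\<exists>B. finite B \<and> B \<subseteq> vecs G \<and>
       vecs G // coset_rel G H = (\<lambda>x. coset_rel G H `` {x}) ` module.span (scl G) B)"

definition sweedler_dual ::
  "('k::field, 'g::ab_group_add) vs \<Rightarrow> ((('g \<Rightarrow> 'g \<Rightarrow> 'k) \<Rightarrow> 'k) \<Rightarrow> 'g) \<Rightarrow> ('g \<Rightarrow> 'g)
    \<Rightarrow> ('k, 'g \<Rightarrow> 'k) vs" where
  "sweedler_dual G \<mu> \<alpha> =
     \<lparr>vecs = {f \<in> vecs (dual G).
        \<exists>J. hom_ideal G \<mu> \<alpha> J \<and> finite_codim G J \<and> J \<subseteq> {x \<in> vecs G. f x = 0}},
      scl = fscale\<rparr>"

definition hom_coalgebra ::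
  "('k::field, 'c::ab_group_add) vs \<Rightarrow> ('c \<Rightarrow> ('c \<Rightarrow> 'c \<Rightarrow> 'k) \<Rightarrow> 'k) \<Rightarrow> ('c \<Rightarrow> 'c) \<Rightarrow> bool" where
  "hom_coalgebra C \<Delta> \<beta> \<longleftrightarrow>
     vspace C \<and> linear_map C (tensor C C) \<Delta> \<and> linear_map C C \<beta> \<and>
     (\<forall>c\<in>vecs C.
        tensor_map C (tensor C C) \<beta> \<Delta> (\<Delta> c) =
        tensor_assoc C C C (tensor_map (tensor C C) C \<Delta> \<beta> (\<Delta> c))) \<and>
     (\<forall>c\<in>vecs C. \<Delta> (\<beta> c) = tensor_map C C \<beta> \<beta> (\<Delta> c))"

text \<open>
  The restriction of the dual of \<open>\<mu>\<close> to the Sweedler dual \<open>G\<degree>\<close>, read as a map into \<open>G\<degree> \<otimes> G\<degree>\<close>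
  through the embedding of \<open>G\<degree> \<otimes> G\<degree>\<close> into the dual of \<open>G \<otimes> G\<close>.
\<close>

definition sweedler_comult ::
  "('k::field, 'g::ab_group_add) vs \<Rightarrow> ((('g \<Rightarrow> 'g \<Rightarrow> 'k) \<Rightarrow> 'k) \<Rightarrow> 'g) \<Rightarrow> ('g \<Rightarrow> 'g)
    \<Rightarrow> ('g \<Rightarrow> 'k) \<Rightarrow> (('g \<Rightarrow> 'k) \<Rightarrow> ('g \<Rightarrow> 'k) \<Rightarrow> 'k) \<Rightarrow> 'k" where
  "sweedler_comult G \<mu> \<alpha> f =
     inv_into (vecs (tensor (sweedler_dual G \<mu> \<alpha>) (sweedler_dual G \<mu> \<alpha>))) (tensor_to_dual G G)
       (dual_map (tensor G G) \<mu> f)"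

end

theory Submission
  imports Defs
begin

text \<open>
  If \<open>f\<close> vanishes on an ideal \<open>J\<close> of finite codimension and \<open>\<phi>\<^sub>e\<close> are coordinates of \<open>G\<close> modulo \<open>J\<close>
  with respect to representatives \<open>e\<close>, then \<open>f (x y)\<close> is the finite sum of the \<open>\<phi>\<^sub>e x * f (e y)\<close>,
  and both \<open>\<phi>\<^sub>e\<close> and \<open>f (e _)\<close> vanish on \<open>J\<close>; so \<open>\<mu>\<^sup>* f\<close> lies in \<open>G\<degree> \<otimes> G\<degree>\<close>. Since products of
  separating families of functionals separate tensors, elements of \<open>G\<degree> \<otimes> G\<degree>\<close> and
  \<open>G\<degree> \<otimes> (G\<degree> \<otimes> G\<degree>)\<close> are determined by their values at points of \<open>G\<close>. Evaluated there, the axioms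
  of a Hom-coalgebra become those of the Hom-algebra \<open>G\<close>.
\<close>

section \<open>Linear maps on carriers\<close>

lemma vspace_zero: "vspace V \<Longrightarrow> 0 \<in> vecs V"
  by (auto simp: vspace_def module_iff_vector_space[symmetric] module.subspace_0)

lemma vspace_scale: "vspace V \<Longrightarrow> x \<in> vecs V \<Longrightarrow> scl V c x \<in> vecs V"
  by (auto simp: vspace_def module_iff_vector_space[symmetric] module.subspace_scale)

lemma vspace_add: "vspace V \<Longrightarrow> x \<in> vecs V \<Longrightarrow> y \<in> vecs V \<Longrightarrow> x + y \<in> vecs V"
  by (auto simp: vspace_def module_iff_vector_space[symmetric] module.subspace_add)

lemma vspace_diff: "vspace V \<Longrightarrow> x \<in> vecs V \<Longrightarrow> y \<in> vecs V \<Longrightarrow> x - y \<in> vecs V"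
  by (auto simp: vspace_def module_iff_vector_space[symmetric] module.subspace_diff)

lemma vspace_sum: "vspace V \<Longrightarrow> (\<And>a. a \<in> A \<Longrightarrow> f a \<in> vecs V) \<Longrightarrow> sum f A \<in> vecs V"
  by (auto simp: vspace_def module_iff_vector_space[symmetric] intro: module.subspace_sum)

lemma vspace_span_subset: "vspace V \<Longrightarrow> B \<subseteq> vecs V \<Longrightarrow> module.span (scl V) B \<subseteq> vecs V"
  by (auto simp: vspace_def module_iff_vector_space[symmetric] dest: module.span_minimal)

lemma linear_map_in: "linear_map V W f \<Longrightarrow> x \<in> vecs V \<Longrightarrow> f x \<in> vecs W"
  by (auto simp: linear_map_def)

lemma linear_map_add:
  "linear_map V W f \<Longrightarrow> x \<in> vecs V \<Longrightarrow> y \<in> vecs V \<Longrightarrow> f (x + y) = f x + f y"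
  by (simp add: linear_map_def)

lemma linear_map_scale: "linear_map V W f \<Longrightarrow> x \<in> vecs V \<Longrightarrow> f (scl V c x) = scl W c (f x)"
  by (simp add: linear_map_def)

lemma linear_map_zero:
  assumes "vspace V" "linear_map V W f"
  shows "f 0 = 0"
  using linear_map_add[OF assms(2) vspace_zero vspace_zero] assms(1) by simp

lemma linear_map_diff:
  assumes "vspace V" "linear_map V W f" "x \<in> vecs V" "y \<in> vecs V"
  shows "f (x - y) = f x - f y"
  using linear_map_add[OF assms(2) vspace_diff[OF assms(1,3,4)] assms(4)] by (simp add: algebra_simps)

lemma linear_map_lincomb:
  assumes "vspace V" "linear_map V W f" "finite A" "\<And>a. a \<in> A \<Longrightarrow> x a \<in> vecs V"
  shows "f (\<Sum>a\<in>A. scl V (r a) (x a)) = (\<Sum>a\<in>A. scl W (r a) (f (x a)))"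
  using assms(3,4)
proof (induction A rule: finite_induct)
  case empty
  then show ?case using linear_map_zero[OF assms(1,2)] by simp
next
  case (insert a A)
  then show ?case
    using assms(1,2) by (simp add: linear_map_add linear_map_scale vspace_scale vspace_sum)
qed

lemma linear_map_ground_diff_scale:
  assumes "vspace V" "linear_map V ground f" "x \<in> vecs V" "y \<in> vecs V"
  shows "f (x - scl V c y) = f x - c * f y"
  using assms by (simp add: linear_map_diff vspace_scale linear_map_scale)

lemma bilinear_map_tensor_form:
  assumes "linear_map V ground \<phi>" "linear_map W ground \<psi>"
  shows "bilinear_map V W ground (\<lambda>v w. \<phi> v * \<psi> w)"
  using assms unfolding bilinear_map_def linear_map_def by (simp add: algebra_simps)

lemma bilinear_map_cong:
  assumes "vspace V" "vspace W" "\<And>v w. v \<in> vecs V \<Longrightarrow> w \<in> vecs W \<Longrightarrow> b v w = b' v w"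
  shows "bilinear_map V W ground b \<longleftrightarrow> bilinear_map V W ground b'"
  using assms unfolding bilinear_map_def linear_map_def
  by (auto simp: vspace_add vspace_scale)

section \<open>Separation of tensors by products of functionals\<close>

lemma tensor_not_bilinear:
  assumes "t \<in> vecs (tensor V W)" "\<not> bilinear_map V W ground b"
  shows "t b = 0"
  using assms(1)
  by (induction rule: tensor_induct) (use assms(2) in \<open>auto simp: fscale_def pure_tensor_def\<close>)

text \<open>Forms that agree on the carriers are both bilinear or both not. The first case is
  scaling by 1, and in the second both values are 0. This allows rewriting inside the argument of a
  tensor with facts that hold only on the carriers.\<close>

lemma tensor_form_cong:
  assumes "t \<in> vecs (tensor V W)"
    and "vspace V" "vspace W" "\<And>v w. v \<in> vecs V \<Longrightarrow> w \<in> vecs W \<Longrightarrow> b v w = b' v w"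
  shows "t b = t b'"
proof -
  have "bilinear_map V W ground b \<longleftrightarrow> bilinear_map V W ground b'"
    using assms(2-4) by (rule bilinear_map_cong)
  then show ?thesis
    using assms(4) tensor_form_scale[OF assms(1), of b b' 1] tensor_not_bilinear[OF assms(1)]
    by (cases "bilinear_map V W ground b") auto
qed

text \<open>Expanding left factors in the basis and collecting terms writes \<open>t\<close> as the
  sum of the \<open>v \<otimes> w v\<close> over distinct basis vectors \<open>v\<close>. Requiring
  \<open>w v = 0\<close> off \<open>A\<close> lets the induction enlarge \<open>A\<close> without
  changing the sum.\<close>

lemma tensor_expansion:
  assumes V: "vspace V" and W: "vspace W"
    and B: "B \<subseteq> vecs V" "\<not> module.dependent (scl V) B" "vecs V \<subseteq> module.span (scl V) B"
    and t: "t \<in> vecs (tensor V W)"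
  shows "\<exists>A w. finite A \<and> A \<subseteq> B \<and> (\<forall>v. w v \<in> vecs W) \<and> (\<forall>v. v \<notin> A \<longrightarrow> w v = 0) \<and>
    (\<forall>b. bilinear_map V W ground b \<longrightarrow> t b = (\<Sum>v\<in>A. b v (w v)))"
  using t
proof (induction rule: tensor_induct)
  case zero
  show ?case using vspace_zero[OF W] by (intro exI[of _ "{}"] exI[of _ "\<lambda>_. 0"]) simp
next
  case (step c u y t)
  interpret V: vector_space "scl V" using V by (simp add: vspace_def)
  interpret W: vector_space "scl W" using W by (simp add: vspace_def)
  obtain A w where A: "finite A" "A \<subseteq> B" "\<And>v. w v \<in> vecs W" "\<And>v. v \<notin> A \<Longrightarrow> w v = 0"
    and tA: "\<And>b. bilinear_map V W ground b \<Longrightarrow> t b = (\<Sum>v\<in>A. b v (w v))"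
    using step.IH by blast
  define r where "r = V.representation B u"
  define R where "R = {v. r v \<noteq> 0}"
  have u: "u \<in> V.span B" using step B(3) by blast
  have R: "finite R" "R \<subseteq> B"
    unfolding R_def r_def by (auto simp: V.finite_representation intro: V.representation_ne_zero)
  have ur: "u = (\<Sum>v\<in>R. scl V (r v) v)"
    using V.sum_nonzero_representation_eq[OF B(2) u] by (simp add: R_def r_def)
  \<comment> \<open>Expanding \<open>u\<close> in \<open>B\<close> distributes the new term,
    \<open>c\<close> times \<open>u \<otimes> y\<close>, over the basis vectors; \<open>v\<close>
    receives \<open>c * r v\<close> times \<open>y\<close>.\<close>
  define w' where "w' v = w v + scl W (c * r v) y" for v
  have b: "(fscale c (pure_tensor V W u y) + t) b = (\<Sum>v\<in>A \<union> R. b v (w' v))"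
    if b: "bilinear_map V W ground b" for b
  proof -
    have lin: "linear_map W ground (b v)" if "v \<in> B" for v
      using b that B(1) by (auto simp: bilinear_map_def)
    have "b u y = (\<Sum>v\<in>R. r v * b v y)"
      using linear_map_lincomb[OF V, of ground "\<lambda>v. b v y" R "\<lambda>v. v" r] R B(1) b step
      by (auto simp: ur[symmetric] bilinear_map_def)
    also have "\<dots> = (\<Sum>v\<in>A \<union> R. r v * b v y)"
      by (rule sum.mono_neutral_left) (use A R in \<open>auto simp: R_def\<close>)
    finally have 1: "b u y = (\<Sum>v\<in>A \<union> R. r v * b v y)" .
    have 2: "t b = (\<Sum>v\<in>A \<union> R. b v (w v))"
      unfolding tA[OF b]
      by (rule sum.mono_neutral_left) (use A R linear_map_zero[OF W lin] in auto)
    have "b v (w' v) = b v (w v) + c * (r v * b v y)" if "v \<in> A \<union> R" for v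
    proof -
      have l: "linear_map W ground (b v)" using that A R lin by blast
      show ?thesis
        using linear_map_add[OF l A(3) vspace_scale[OF W step(2)]] linear_map_scale[OF l step(2)]
        by (simp add: w'_def mult.assoc)
    qed
    then show ?thesis using b
      by (simp add: fscale_def pure_tensor_def 1 2 sum.distrib sum_distrib_left)
  qed
  show ?case
    by (rule exI[of _ "A \<union> R"], rule exI[of _ w'])
      (use A R b W step in \<open>auto simp: w'_def vspace_add vspace_scale R_def\<close>)
qed

definition separating :: "('k::field, 'v::ab_group_add) vs \<Rightarrow> ('v \<Rightarrow> 'k) set \<Rightarrow> bool" where
  "separating V \<Phi> \<longleftrightarrow> (\<forall>\<phi>\<in>\<Phi>. linear_map V ground \<phi>) \<and>
     (\<forall>v\<in>vecs V. (\<forall>\<phi>\<in>\<Phi>. \<phi> v = 0) \<longrightarrow> v = 0)"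

lemma separating_eqI:
  assumes "separating V \<Phi>" "vspace V" "v \<in> vecs V" "w \<in> vecs V" "\<And>\<phi>. \<phi> \<in> \<Phi> \<Longrightarrow> \<phi> v = \<phi> w"
  shows "v = w"
  using assms linear_map_diff[OF assms(2) _ assms(3,4)] vspace_diff[OF assms(2-4)]
  unfolding separating_def by (metis eq_iff_diff_eq_0)

text \<open>These are the functionals \<open>\<phi> \<otimes> \<psi>\<close>: a tensor is itself a
  function of bilinear forms, so applying \<open>\<phi> \<otimes> \<psi>\<close> means evaluating it
  at the product form.\<close>

definition tensor_functionals ::
  "('v \<Rightarrow> 'k::field) set \<Rightarrow> ('w \<Rightarrow> 'k) set \<Rightarrow> ((('v \<Rightarrow> 'w \<Rightarrow> 'k) \<Rightarrow> 'k) \<Rightarrow> 'k) set" where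
  "tensor_functionals \<Phi> \<Psi> = {\<lambda>t. t (\<lambda>v w. \<phi> v * \<psi> w) | \<phi> \<psi>. \<phi> \<in> \<Phi> \<and> \<psi> \<in> \<Psi>}"

text \<open>
  Expand a tensor along a basis of the left factor: pairing with \<open>\<psi>\<close> on the right gives a linear
  combination of basis vectors, which vanishes because \<open>\<Phi>\<close> separates, so \<open>\<psi>\<close> kills every right
  coefficient.
\<close>

lemma separating_tensor:
  assumes V: "vspace V" "separating V \<Phi>" and W: "vspace W" "separating W \<Psi>"
  shows "separating (tensor V W) (tensor_functionals \<Phi> \<Psi>)"
  unfolding separating_def
proof (intro conjI ballI impI)
  fix \<chi> assume "\<chi> \<in> tensor_functionals \<Phi> \<Psi>"
  then show "linear_map (tensor V W) ground \<chi>"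
    by (auto simp: tensor_functionals_def linear_map_def fscale_def)
next
  fix t assume t: "t \<in> vecs (tensor V W)" and z: "\<forall>\<chi>\<in>tensor_functionals \<Phi> \<Psi>. \<chi> t = 0"
  interpret V: vector_space "scl V" using V(1) by (simp add: vspace_def)
  obtain B where B: "B \<subseteq> vecs V" "V.independent B" "vecs V \<subseteq> V.span B"
    using V.maximal_independent_subset by blast
  obtain A w where A: "finite A" "A \<subseteq> B" "\<And>v. w v \<in> vecs W"
    and tA: "\<And>b. bilinear_map V W ground b \<Longrightarrow> t b = (\<Sum>v\<in>A. b v (w v))"
    using tensor_expansion[OF V(1) W(1) B t] by blast
  have "\<psi> (w v) = 0" if \<psi>: "\<psi> \<in> \<Psi>" and v: "v \<in> A" for \<psi> v
  proof -
    let ?u = "\<Sum>v\<in>A. scl V (\<psi> (w v)) v"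
    have "\<phi> ?u = 0" if \<phi>: "\<phi> \<in> \<Phi>" for \<phi>
    proof -
      have l: "linear_map V ground \<phi>" "linear_map W ground \<psi>"
        using V(2) W(2) \<phi> \<psi> by (auto simp: separating_def)
      have "\<phi> ?u = (\<Sum>v\<in>A. \<phi> v * \<psi> (w v))"
        using linear_map_lincomb[OF V(1) l(1) A(1), of "\<lambda>v. v"] A(2) B(1)
        by (simp add: mult.commute subset_iff)
      also have "\<dots> = t (\<lambda>v w. \<phi> v * \<psi> w)"
        using tA[OF bilinear_map_tensor_form[OF l]] by simp
      also have "\<dots> = 0" using z \<phi> \<psi> by (auto simp: tensor_functionals_def)
      finally show ?thesis .
    qed
    moreover have "?u \<in> vecs V"
      using V(1) A(2) B(1) by (auto intro!: vspace_sum vspace_scale)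
    ultimately have "?u = 0" using V(2) by (auto simp: separating_def)
    then show ?thesis
      using V.independentD[OF B(2) A(1,2), of "\<lambda>v. \<psi> (w v)" v] v by simp
  qed
  then have w: "w v = 0" if "v \<in> A" for v
    using W(2) A(3) that by (auto simp: separating_def)
  show "t = 0"
  proof
    fix b
    show "t b = 0 b"
    proof (cases "bilinear_map V W ground b")
      case True
      have "b v (w v) = 0" if "v \<in> A" for v
        using linear_map_zero[OF W(1), of ground "b v"] True A(2) B(1) that w
        by (auto simp: bilinear_map_def)
      then show ?thesis using tA[OF True] by simp
    next
      case False
      then show ?thesis using tensor_not_bilinear[OF t] by simp
    qed
  qed
qed

section \<open>Subspaces of finite codimension\<close>

text \<open>As \<open>J\<close> is a subspace, elements of \<open>G\<close> have equal cosets iff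
  their difference lies in \<open>J\<close>. The projection of \<open>span B\<close> always lands in
  the quotient, so only surjectivity is at stake.\<close>

lemma finite_codim_iff:
  assumes G: "vspace G" and J: "module.subspace (scl G) J" "J \<subseteq> vecs G"
  shows "finite_codim G J \<longleftrightarrow>
    (\<exists>B. finite B \<and> B \<subseteq> vecs G \<and> (\<forall>x\<in>vecs G. \<exists>b\<in>module.span (scl G) B. x - b \<in> J))"
proof -
  interpret G: vector_space "scl G" using G by (simp add: vspace_def)
  have eqv: "equiv (vecs G) (coset_rel G J)"
  proof (rule equivI)
    show "sym (coset_rel G J)"
      using G.subspace_neg[OF J(1)] by (force simp: sym_def coset_rel_def)
    show "trans (coset_rel G J)"
      using G.subspace_add[OF J(1)] by (force simp: trans_def coset_rel_def)
  qed (auto simp: refl_on_def coset_rel_def G.subspace_0[OF J(1)])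
  have "vecs G // coset_rel G J = (\<lambda>x. coset_rel G J `` {x}) ` G.span B \<longleftrightarrow>
      (\<forall>x\<in>vecs G. \<exists>b\<in>G.span B. x - b \<in> J)" if B: "B \<subseteq> vecs G" for B
  proof -
    have SG: "G.span B \<subseteq> vecs G" using vspace_span_subset[OF G B] .
    then have "(\<lambda>x. coset_rel G J `` {x}) ` G.span B \<subseteq> vecs G // coset_rel G J"
      by (auto simp: quotient_def)
    then have "vecs G // coset_rel G J = (\<lambda>x. coset_rel G J `` {x}) ` G.span B \<longleftrightarrow>
        vecs G // coset_rel G J \<subseteq> (\<lambda>x. coset_rel G J `` {x}) ` G.span B" by blast
    also have "\<dots> \<longleftrightarrow> (\<forall>x\<in>vecs G. \<exists>b\<in>G.span B. coset_rel G J `` {x} = coset_rel G J `` {b})"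
      by (auto simp: quotient_def)
    also have "\<dots> \<longleftrightarrow> (\<forall>x\<in>vecs G. \<exists>b\<in>G.span B. x - b \<in> J)"
      using SG eq_equiv_class_iff[OF eqv] by (intro ball_cong bex_cong) (auto simp: coset_rel_def)
    finally show ?thesis .
  qed
  then show ?thesis unfolding finite_codim_def by (intro ex_cong1 conj_cong refl) simp
qed

text \<open>A basis \<open>C\<close> of \<open>J\<close> is extended to a basis \<open>D\<close> of
  \<open>G\<close>. The added vectors \<open>E\<close> represent a basis of \<open>G/J\<close>, and
  the \<open>\<phi> e\<close> are the corresponding coordinates with respect to
  \<open>D\<close>.\<close>

lemma finite_codim_coordinates:
  assumes G: "vspace G" and J: "module.subspace (scl G) J" "J \<subseteq> vecs G" and fin: "finite_codim G J"
  obtains E \<phi> where "finite E" "E \<subseteq> vecs G" "\<And>e. \<phi> e \<in> vecs (dual G)"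
    "\<And>e x. e \<in> E \<Longrightarrow> x \<in> J \<Longrightarrow> \<phi> e x = 0"
    "\<And>x. x \<in> vecs G \<Longrightarrow> x - (\<Sum>e\<in>E. scl G (\<phi> e x) e) \<in> J"
proof -
  interpret G: vector_space "scl G" using G by (simp add: vspace_def)
  obtain B where B: "finite B" "B \<subseteq> vecs G" "\<And>x. x \<in> vecs G \<Longrightarrow> \<exists>b\<in>G.span B. x - b \<in> J"
    using iffD1[OF finite_codim_iff[OF G J] fin] by blast
  obtain C where C: "C \<subseteq> J" "G.independent C" "J \<subseteq> G.span C"
    using G.maximal_independent_subset by blast
  have CJ: "G.span C = J" using C(3) G.span_minimal[OF C(1) J(1)] by blast
  \<comment> \<open>Extending only by vectors of \<open>B\<close> keeps \<open>D - C\<close>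
    finite.\<close>
  obtain D where D: "C \<subseteq> D" "D \<subseteq> C \<union> B" "G.independent D" "C \<union> B \<subseteq> G.span D"
    using G.maximal_independent_subset_extend[of C "C \<union> B"] C(2) by blast
  have GD: "x \<in> G.span D" if x: "x \<in> vecs G" for x
  proof -
    obtain b where b: "b \<in> G.span B" "x - b \<in> J" using B(3)[OF x] by blast
    have "b \<in> G.span D" "x - b \<in> G.span D"
      using b D(1,4) C(3) G.span_mono[OF D(1)] G.span_minimal[of B "G.span D"] by auto
    then show ?thesis using G.span_add by fastforce
  qed
  define E where "E = D - C"
  define \<phi> where "\<phi> e x = (if x \<in> vecs G then G.representation D x e else 0)" for e x
  have E: "finite E" "E \<subseteq> vecs G"
    using D(2) B(1,2) finite_subset[of E B] by (auto simp: E_def)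
  moreover have "\<phi> e \<in> vecs (dual G)" for e
    using D(3) GD G
    by (auto simp: dual_def linear_map_def \<phi>_def G.representation_add G.representation_scale
        vspace_add vspace_scale)
  \<comment> \<open>A vector of \<open>J\<close> is already represented over \<open>C\<close>, so
    its coordinates outside \<open>C\<close> are zero.\<close>
  moreover have "\<phi> e x = 0" if "e \<in> E" "x \<in> J" for e x
    using that G.representation_extend[OF D(3) _ D(1), of x] G.representation_ne_zero[of C x e]
    by (auto simp: \<phi>_def CJ E_def)
  moreover have "x - (\<Sum>e\<in>E. scl G (\<phi> e x) e) \<in> J" if x: "x \<in> vecs G" for x
  proof -
    let ?r = "G.representation D x"
    let ?R = "{v. ?r v \<noteq> 0}"
    have R: "finite ?R" "?R \<subseteq> D" by (auto simp: G.finite_representation intro: G.representation_ne_zero)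
    have "x = (\<Sum>v\<in>?R. scl G (?r v) v)"
      using G.sum_nonzero_representation_eq[OF D(3) GD[OF x]] by simp
    \<comment> \<open>\<open>C\<close> may be infinite, so only its part in the support of
      \<open>x\<close> is summed; \<open>E\<close> is finite and can be included whole, the extra
      terms being zero.\<close>
    also have "\<dots> = (\<Sum>v\<in>(?R \<inter> C) \<union> E. scl G (?r v) v)"
      by (rule sum.mono_neutral_left) (use R E in \<open>auto simp: E_def\<close>)
    also have "\<dots> = (\<Sum>v\<in>?R \<inter> C. scl G (?r v) v) + (\<Sum>v\<in>E. scl G (?r v) v)"
      by (rule sum.union_disjoint) (use R E in \<open>auto simp: E_def\<close>)
    finally have "x - (\<Sum>e\<in>E. scl G (\<phi> e x) e) = (\<Sum>v\<in>?R \<inter> C. scl G (?r v) v)"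
      using x by (simp add: \<phi>_def algebra_simps)
    also have "\<dots> \<in> J"
      using C(1) by (auto intro!: G.subspace_sum[OF J(1)] G.subspace_scale[OF J(1)])
    finally show ?thesis .
  qed
  ultimately show ?thesis by (rule that)
qed

lemma subspace_Int_kernel:
  assumes "vspace G" "module.subspace (scl G) J" "J \<subseteq> vecs G" "linear_map G ground \<phi>"
  shows "module.subspace (scl G) {x \<in> J. \<phi> x = 0}"
proof -
  interpret G: vector_space "scl G" using assms(1) by (simp add: vspace_def)
  show ?thesis
    using assms(2,3) linear_map_zero[OF assms(1,4)] linear_map_add[OF assms(4)]
      linear_map_scale[OF assms(4)]
    unfolding G.subspace_def by (simp add: subset_iff)
qed

text \<open>One kernel raises the codimension by at most one: if \<open>\<phi>\<close> is nonzero at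
  some \<open>v\<close> in \<open>J\<close>, adding \<open>v\<close> to the spanning set suffices;
  otherwise nothing is cut off.\<close>

lemma finite_codim_Int_kernel:
  assumes G: "vspace G" and J: "module.subspace (scl G) J" "J \<subseteq> vecs G" and fin: "finite_codim G J"
    and \<phi>: "linear_map G ground \<phi>"
  shows "finite_codim G {x \<in> J. \<phi> x = 0}"
proof (cases "\<exists>v\<in>J. \<phi> v \<noteq> 0")
  case True
  interpret G: vector_space "scl G" using G by (simp add: vspace_def)
  obtain v where v: "v \<in> J" "\<phi> v \<noteq> 0" using True by blast
  obtain B where B: "finite B" "B \<subseteq> vecs G" "\<And>x. x \<in> vecs G \<Longrightarrow> \<exists>b\<in>G.span B. x - b \<in> J"
    using iffD1[OF finite_codim_iff[OF G J] fin] by blast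
  have "\<exists>b\<in>G.span (insert v B). x - b \<in> {x \<in> J. \<phi> x = 0}" if x: "x \<in> vecs G" for x
  proof -
    obtain b where b: "b \<in> G.span B" "x - b \<in> J" using B(3)[OF x] by blast
    \<comment> \<open>The multiple of \<open>v\<close> to be subtracted from \<open>x - b\<close> so
      that \<open>\<phi>\<close> vanishes on the result.\<close>
    let ?c = "\<phi> (x - b) / \<phi> v"
    have "b + scl G ?c v \<in> G.span (insert v B)"
      using subsetD[OF G.span_mono[OF subset_insertI] b(1)]
      by (simp add: G.span_add G.span_scale G.span_base)
    moreover have "(x - b) - scl G ?c v \<in> J"
      by (rule G.subspace_diff[OF J(1) b(2) G.subspace_scale[OF J(1) v(1)]])
    moreover have "\<phi> ((x - b) - scl G ?c v) = 0"
      using linear_map_ground_diff_scale[OF G \<phi>, of "x - b" v ?c] b v J(2) by (simp add: subset_iff)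
    ultimately show ?thesis by (metis (mono_tags, lifting) diff_diff_eq mem_Collect_eq)
  qed
  then show ?thesis
    using J(2) B(1,2) v
    by (intro iffD2[OF finite_codim_iff[OF G subspace_Int_kernel[OF G J \<phi>]]] exI[of _ "insert v B"])
      auto
next
  case False
  then have "{x \<in> J. \<phi> x = 0} = J" by blast
  with fin show ?thesis by simp
qed

text \<open>\<open>K\<close> is the common kernel in \<open>G\<close> of finitely many coordinates
  modulo \<open>K\<close>, so \<open>J \<inter> K\<close> arises from \<open>J\<close> by finitely
  many cuts with a kernel.\<close>

lemma finite_codim_Int:
  assumes G: "vspace G" and J: "module.subspace (scl G) J" "J \<subseteq> vecs G" "finite_codim G J"
    and K: "module.subspace (scl G) K" "K \<subseteq> vecs G" "finite_codim G K"
  shows "finite_codim G (J \<inter> K)"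
proof -
  interpret G: vector_space "scl G" using G by (simp add: vspace_def)
  obtain E \<phi> where E: "finite E" "E \<subseteq> vecs G" "\<And>e. \<phi> e \<in> vecs (dual G)"
    "\<And>e x. e \<in> E \<Longrightarrow> x \<in> K \<Longrightarrow> \<phi> e x = 0"
    "\<And>x. x \<in> vecs G \<Longrightarrow> x - (\<Sum>e\<in>E. scl G (\<phi> e x) e) \<in> K"
    by (rule finite_codim_coordinates[OF G K]) (rule that)
  \<comment> \<open>With all coordinates zero, the combination subtracted from \<open>x\<close> is
    zero, so \<open>x\<close> itself lies in \<open>K\<close>.\<close>
  have "x \<in> K" if "x \<in> J" "\<And>e. e \<in> E \<Longrightarrow> \<phi> e x = 0" for x
    using E(5)[of x] that J(2) by auto
  then have eq: "J \<inter> K = {x \<in> J. \<forall>e\<in>E. \<phi> e x = 0}" using E(4) by blast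
  have "module.subspace (scl G) {x \<in> J. \<forall>e\<in>E. \<phi> e x = 0} \<and>
      finite_codim G {x \<in> J. \<forall>e\<in>E. \<phi> e x = 0}"
    using E(1)
  proof (induction E rule: finite_induct)
    case (insert e E)
    let ?J = "{x \<in> J. \<forall>e\<in>E. \<phi> e x = 0}"
    have "linear_map G ground (\<phi> e)" using E(3) by (simp add: dual_def)
    moreover have "{x \<in> ?J. \<phi> e x = 0} = {x \<in> J. \<forall>e'\<in>insert e E. \<phi> e' x = 0}" by blast
    ultimately show ?case
      using finite_codim_Int_kernel[OF G, of ?J "\<phi> e"] subspace_Int_kernel[OF G, of ?J "\<phi> e"]
        insert.IH J(2) by (simp add: subset_iff)
  qed (use J in auto)
  then show ?thesis using eq by simp
qed

section \<open>The Sweedler dual\<close>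

lemma hom_ideal_Int:
  assumes "vspace G" "hom_ideal G \<mu> \<alpha> J" "hom_ideal G \<mu> \<alpha> K"
  shows "hom_ideal G \<mu> \<alpha> (J \<inter> K)"
proof -
  interpret G: vector_space "scl G" using assms(1) by (simp add: vspace_def)
  show ?thesis using assms(2,3) unfolding hom_ideal_def by (auto intro: G.subspace_inter)
qed

lemma scl_sweedler_dual [simp]: "scl (sweedler_dual G \<mu> \<alpha>) = fscale"
  by (simp add: sweedler_dual_def)

lemma sweedler_dual_subset_dual: "vecs (sweedler_dual G \<mu> \<alpha>) \<subseteq> vecs (dual G)"
  by (auto simp: sweedler_dual_def)

lemma sweedler_dualI:
  assumes "f \<in> vecs (dual G)" "hom_ideal G \<mu> \<alpha> J" "finite_codim G J" "\<And>x. x \<in> J \<Longrightarrow> f x = 0"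
  shows "f \<in> vecs (sweedler_dual G \<mu> \<alpha>)"
proof -
  have "J \<subseteq> {x \<in> vecs G. f x = 0}" using assms(2,4) by (auto simp: hom_ideal_def)
  then show ?thesis using assms(1-3) unfolding sweedler_dual_def by (simp, blast)
qed

lemma sweedler_dualE:
  assumes "f \<in> vecs (sweedler_dual G \<mu> \<alpha>)"
  obtains J where "linear_map G ground f" "hom_ideal G \<mu> \<alpha> J" "finite_codim G J"
    "\<And>x. x \<in> J \<Longrightarrow> f x = 0"
proof -
  obtain J where "linear_map G ground f" "hom_ideal G \<mu> \<alpha> J" "finite_codim G J"
    "J \<subseteq> {x \<in> vecs G. f x = 0}"
    using assms unfolding sweedler_dual_def dual_def by (simp, blast)
  then show ?thesis by (intro that[of J]) auto
qed

section \<open>Evaluating functionals and their tensors at points of \<open>G\<close>\<close>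

lemma tensor_to_dual_pure_tensor:
  assumes F: "vspace F" "vecs F \<subseteq> vecs (dual V)" "scl F = fscale"
    and F': "vspace F'" "vecs F' \<subseteq> vecs (dual W)" "scl F' = fscale"
    and t: "t \<in> vecs (tensor F F')" and xy: "x \<in> vecs V" "y \<in> vecs W"
  shows "tensor_to_dual V W t (pure_tensor V W x y) = t (\<lambda>f g. f x * g y)"
proof -
  have "t (\<lambda>f g. pure_tensor V W x y (\<lambda>x y. f x * g y)) = t (\<lambda>f g. f x * g y)"
  proof (rule tensor_form_cong[OF t F(1) F'(1)])
    fix f g assume "f \<in> vecs F" "g \<in> vecs F'"
    then have "bilinear_map V W ground (\<lambda>x y. f x * g y)"
      using F F' by (blast intro: bilinear_map_product_form)
    then show "pure_tensor V W x y (\<lambda>x y. f x * g y) = f x * g y"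
      by (simp add: pure_tensor_def)
  qed
  then show ?thesis using xy by (simp add: tensor_to_dual_def pure_tensor_in)
qed

definition point_evaluations :: "('k::field, 'g::ab_group_add) vs \<Rightarrow> (('g \<Rightarrow> 'k) \<Rightarrow> 'k) set" where
  "point_evaluations G = (\<lambda>x f. f x) ` vecs G"

text \<open>Elements of \<open>dual G\<close> are zero outside \<open>vecs G\<close> by convention,
  so vanishing at every point of \<open>G\<close> makes them the zero function.\<close>

lemma separating_point_evaluations:
  assumes "vecs F \<subseteq> vecs (dual G)" "scl F = fscale"
  shows "separating F (point_evaluations G)"
  using assms unfolding separating_def point_evaluations_def linear_map_def dual_def
  by (fastforce simp: fscale_def fun_eq_iff)

lemma sum_fun_apply: "(\<Sum>a\<in>A. F a) x = (\<Sum>a\<in>A. F a x)"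
  by (induction A rule: infinite_finite_induct) auto

context
  fixes G :: "('k::field, 'g::ab_group_add) vs"
    and \<mu> :: "(('g \<Rightarrow> 'g \<Rightarrow> 'k) \<Rightarrow> 'k) \<Rightarrow> 'g"
    and \<alpha> :: "'g \<Rightarrow> 'g"
  assumes hom_algebra: "hom_algebra G \<mu> \<alpha>"
begin

private abbreviation (input) "m x y \<equiv> \<mu> (pure_tensor G G x y)"
private abbreviation (input) "S \<equiv> sweedler_dual G \<mu> \<alpha>"
private abbreviation (input) "\<Delta> \<equiv> sweedler_comult G \<mu> \<alpha>"
private abbreviation (input) "\<beta> \<equiv> dual_map G \<alpha>"

lemma vspace_G: "vspace G" and linear_\<mu>: "linear_map (tensor G G) G \<mu>"
  and linear_\<alpha>: "linear_map G G \<alpha>"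
  using hom_algebra by (auto simp: hom_algebra_def)

lemma hom_assoc:
  "g \<in> vecs G \<Longrightarrow> h \<in> vecs G \<Longrightarrow> k \<in> vecs G \<Longrightarrow> m (\<alpha> g) (m h k) = m (m g h) (\<alpha> k)"
  and \<alpha>_mult: "h \<in> vecs G \<Longrightarrow> k \<in> vecs G \<Longrightarrow> \<alpha> (m h k) = m (\<alpha> h) (\<alpha> k)"
  using hom_algebra by (auto simp: hom_algebra_def Let_def)

lemma mult_in: "x \<in> vecs G \<Longrightarrow> y \<in> vecs G \<Longrightarrow> m x y \<in> vecs G"
  by (rule linear_map_in[OF linear_\<mu> pure_tensor_in])

lemma \<alpha>_in: "x \<in> vecs G \<Longrightarrow> \<alpha> x \<in> vecs G"
  by (rule linear_map_in[OF linear_\<alpha>])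

lemma bilinear_mult: "bilinear_map G G G (\<lambda>x y. m x y)"
  using bilinear_map_pure_tensor[OF vspace_G vspace_G] linear_\<mu> mult_in
  unfolding bilinear_map_def linear_map_def by (auto simp: pure_tensor_in)

lemma linear_map_mult_left:
  assumes "linear_map G ground f" "x \<in> vecs G"
  shows "linear_map G ground (\<lambda>y. f (m x y))"
  using bilinear_mult assms mult_in unfolding bilinear_map_def linear_map_def by auto

lemma linear_map_mult_right:
  assumes "linear_map G ground f" "y \<in> vecs G"
  shows "linear_map G ground (\<lambda>x. f (m x y))"
  using bilinear_mult assms mult_in unfolding bilinear_map_def linear_map_def by auto

text \<open>A sum vanishes on the intersection of the two ideals, which again is an ideal of finite
  codimension; a scalar multiple keeps the ideal of \<open>f\<close>.\<close>

lemma vspace_sweedler_dual: "vspace S"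
proof -
  interpret G: vector_space "scl G" using vspace_G by (simp add: vspace_def)
  have dual: "module.subspace fscale (vecs (dual G))"
    unfolding module.subspace_def[OF module_fscale]
    using vspace_G by (auto simp: dual_def linear_map_def fscale_def algebra_simps vspace_add vspace_scale)
  \<comment> \<open>\<open>G\<close> itself, of codimension 0, supplies an ideal for the zero
    functional.\<close>
  have "hom_ideal G \<mu> \<alpha> (vecs G)"
    using vspace_G mult_in \<alpha>_in by (auto simp: hom_ideal_def vspace_def)
  moreover have "finite_codim G (vecs G)"
    using vspace_G
    by (subst finite_codim_iff) (auto simp: vspace_def intro!: exI[of _ "{}"])
  ultimately have "\<exists>J. hom_ideal G \<mu> \<alpha> J \<and> finite_codim G J" by blast
  then have 0: "0 \<in> vecs S"
    using module.subspace_0[OF module_fscale dual] by (auto intro: sweedler_dualI)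
  have add: "f + g \<in> vecs S" if f: "f \<in> vecs S" and g: "g \<in> vecs S" for f g
  proof -
    obtain J where J: "hom_ideal G \<mu> \<alpha> J" "finite_codim G J" "\<And>x. x \<in> J \<Longrightarrow> f x = 0"
      using sweedler_dualE[OF f] by blast
    obtain K where K: "hom_ideal G \<mu> \<alpha> K" "finite_codim G K" "\<And>x. x \<in> K \<Longrightarrow> g x = 0"
      using sweedler_dualE[OF g] by blast
    have "finite_codim G (J \<inter> K)"
      using finite_codim_Int[OF vspace_G _ _ J(2) _ _ K(2)] J(1) K(1) by (simp add: hom_ideal_def)
    moreover have "f + g \<in> vecs (dual G)"
      using module.subspace_add[OF module_fscale dual] f g sweedler_dual_subset_dual by blast
    ultimately show ?thesis
      using hom_ideal_Int[OF vspace_G J(1) K(1)] J(3) K(3)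
      by (intro sweedler_dualI[of _ _ _ _ "J \<inter> K"]) auto
  qed
  have "fscale c f \<in> vecs S" if f: "f \<in> vecs S" for c f
  proof -
    obtain J where J: "hom_ideal G \<mu> \<alpha> J" "finite_codim G J" "\<And>x. x \<in> J \<Longrightarrow> f x = 0"
      using sweedler_dualE[OF f] by blast
    have "fscale c f \<in> vecs (dual G)"
      using module.subspace_scale[OF module_fscale dual] f sweedler_dual_subset_dual by blast
    with J show ?thesis
      by (intro sweedler_dualI[of _ _ _ _ J]) (auto simp: fscale_def)
  qed
  with 0 add show ?thesis
    unfolding vspace_def scl_sweedler_dual module.subspace_def[OF module_fscale]
    by (simp add: vector_space_fscale del: zero_fun_apply)
qed

lemmas sweedler_dual_space = vspace_sweedler_dual sweedler_dual_subset_dual[of G \<mu> \<alpha>] scl_sweedler_dual[of G \<mu> \<alpha>]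

lemma separating_sweedler_dual: "separating S (point_evaluations G)"
  by (rule separating_point_evaluations[OF sweedler_dual_space(2,3)])

text \<open>Point evaluations separate \<open>S\<close>, hence their products separate
  \<open>S \<otimes> S\<close>. Identities between such tensors are proved below by comparing values
  at pairs of points.\<close>

lemma tensor_sweedler_dual_eqI:
  assumes "s \<in> vecs (tensor S S)" "t \<in> vecs (tensor S S)"
    and "\<And>x y. x \<in> vecs G \<Longrightarrow> y \<in> vecs G \<Longrightarrow> s (\<lambda>f g. f x * g y) = t (\<lambda>f g. f x * g y)"
  shows "s = t"
  by (rule separating_eqI[OF separating_tensor vspace_tensor assms(1,2)])
    (use assms(3) separating_sweedler_dual vspace_sweedler_dual
      in \<open>auto simp: tensor_functionals_def point_evaluations_def\<close>)

text \<open>Separation of tensors is applied twice; the nested form evaluates at three points with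
  the bracketing of \<open>S \<otimes> (S \<otimes> S)\<close>.\<close>

lemma tensor3_sweedler_dual_eqI:
  assumes "s \<in> vecs (tensor S (tensor S S))" "t \<in> vecs (tensor S (tensor S S))"
    and "\<And>x y z. x \<in> vecs G \<Longrightarrow> y \<in> vecs G \<Longrightarrow> z \<in> vecs G \<Longrightarrow>
      s (\<lambda>f u. f x * u (\<lambda>g h. g y * h z)) = t (\<lambda>f u. f x * u (\<lambda>g h. g y * h z))"
  shows "s = t"
  by (rule separating_eqI[OF separating_tensor[OF _ _ vspace_tensor separating_tensor]
        vspace_tensor assms(1,2)])
    (use assms(3) separating_sweedler_dual vspace_sweedler_dual
      in \<open>auto simp: tensor_functionals_def point_evaluations_def\<close>)

text \<open>The values of the image at pure tensors of points determine the tensor. This identifies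
  \<open>S \<otimes> S\<close> with a subspace of the dual of \<open>G \<otimes> G\<close>.\<close>

lemma inj_on_tensor_to_dual: "inj_on (tensor_to_dual G G) (vecs (tensor S S))"
proof (rule inj_onI)
  fix s t assume st: "s \<in> vecs (tensor S S)" "t \<in> vecs (tensor S S)"
    "tensor_to_dual G G s = tensor_to_dual G G t"
  note p = tensor_to_dual_pure_tensor[OF sweedler_dual_space sweedler_dual_space]
  show "s = t" using st p[OF st(1)] p[OF st(2)] by (intro tensor_sweedler_dual_eqI) auto
qed

section \<open>The transposes of \<alpha> and \<mu> on the Sweedler dual\<close>

lemma dual_map_\<alpha>_in: "f \<in> vecs S \<Longrightarrow> \<beta> f \<in> vecs S"
proof -
  assume f: "f \<in> vecs S"
  obtain J where J: "linear_map G ground f" "hom_ideal G \<mu> \<alpha> J" "finite_codim G J"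
      "\<And>x. x \<in> J \<Longrightarrow> f x = 0"
    by (rule sweedler_dualE[OF f]) (rule that)
  show ?thesis
  proof (rule sweedler_dualI[OF _ J(2,3)])
    show "\<beta> f \<in> vecs (dual G)"
      using J(1) linear_\<alpha> vspace_G
      by (auto simp: dual_def dual_map_def linear_map_def vspace_add vspace_scale image_subset_iff)
    \<comment> \<open>The ideal of \<open>f\<close> serves again, since \<alpha> maps it into
      itself.\<close>
    show "\<beta> f x = 0" if "x \<in> J" for x
      using J(2,4) that by (auto simp: dual_map_def hom_ideal_def)
  qed
qed

lemma linear_\<beta>: "linear_map S S \<beta>"
  using dual_map_\<alpha>_in by (auto simp: linear_map_def dual_map_def fscale_def)

lemma dual_map_\<mu>_in:
  assumes f: "f \<in> vecs S"
  shows "dual_map (tensor G G) \<mu> f \<in> tensor_to_dual G G ` vecs (tensor S S)"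
proof -
  obtain J where J: "linear_map G ground f" "hom_ideal G \<mu> \<alpha> J" "finite_codim G J"
      "\<And>x. x \<in> J \<Longrightarrow> f x = 0"
    by (rule sweedler_dualE[OF f]) (rule that)
  have J': "module.subspace (scl G) J" "J \<subseteq> vecs G" using J(2) by (auto simp: hom_ideal_def)
  have ideal: "m a b \<in> J" "m b a \<in> J" if "a \<in> vecs G" "b \<in> J" for a b
    using J(2) that by (auto simp: hom_ideal_def)
  obtain E \<phi> where E: "finite E" "E \<subseteq> vecs G" "\<And>e. \<phi> e \<in> vecs (dual G)"
    "\<And>e x. e \<in> E \<Longrightarrow> x \<in> J \<Longrightarrow> \<phi> e x = 0"
    "\<And>x. x \<in> vecs G \<Longrightarrow> x - (\<Sum>e\<in>E. scl G (\<phi> e x) e) \<in> J"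
    by (rule finite_codim_coordinates[OF vspace_G J' J(3)]) (rule that)
  \<comment> \<open>The functional \<open>f (e _)\<close>, set to zero outside \<open>G\<close> as
    membership in \<open>dual G\<close> demands.\<close>
  define h where "h e = (\<lambda>y. if y \<in> vecs G then f (m e y) else 0)" for e
  have \<phi>: "\<phi> e \<in> vecs S" if "e \<in> E" for e
    using E(3,4) that by (blast intro: sweedler_dualI[OF _ J(2,3)])
  have h: "h e \<in> vecs S" if e: "e \<in> E" for e
  proof (rule sweedler_dualI[OF _ J(2,3)])
    have "linear_map G ground (\<lambda>y. f (m e y))"
      using linear_map_mult_left[OF J(1)] E(2) e by blast
    then show "h e \<in> vecs (dual G)"
      using vspace_G by (auto simp: dual_def h_def linear_map_def vspace_add vspace_scale)
    show "h e x = 0" if "x \<in> J" for x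
      using ideal J(4) E(2) e that by (auto simp: h_def)
  qed
  define t where "t = (\<Sum>e\<in>E. pure_tensor S S (\<phi> e) (h e))"
  have t: "t \<in> vecs (tensor S S)"
    unfolding t_def using \<phi> h by (intro vspace_sum[OF vspace_tensor] pure_tensor_in)
  have eq: "dual_map (tensor G G) \<mu> f (pure_tensor G G x y) =
      tensor_to_dual G G t (pure_tensor G G x y)" if x: "x \<in> vecs G" and y: "y \<in> vecs G" for x y
  proof -
    note l = linear_map_mult_right[OF J(1) y]
    let ?x = "\<Sum>e\<in>E. scl G (\<phi> e x) e"
    have "?x \<in> vecs G" using E(2) by (blast intro: vspace_sum[OF vspace_G] vspace_scale[OF vspace_G])
    then have "f (m x y) = f (m ?x y) + f (m (x - ?x) y)"
      using linear_map_diff[OF vspace_G l x] by simp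
    \<comment> \<open>Here \<open>J\<close> is used as a right ideal; that \<open>h e\<close>
      vanishes on \<open>J\<close> used it as a left ideal.\<close>
    also have "f (m (x - ?x) y) = 0"
      using E(5)[OF x] ideal(2) y J(4) by blast
    also have "f (m ?x y) = (\<Sum>e\<in>E. \<phi> e x * f (m e y))"
      using linear_map_lincomb[OF vspace_G l E(1), of "\<lambda>e. e"] E(2) by (simp add: subset_iff)
    also have "\<dots> = t (\<lambda>f g. f x * g y)"
      using bilinear_map_tensor_form[of S "\<lambda>f. f x" S "\<lambda>g. g y"] separating_sweedler_dual x y
      by (simp add: t_def sum_fun_apply pure_tensor_def h_def separating_def point_evaluations_def)
    finally show ?thesis
      using tensor_to_dual_pure_tensor[OF sweedler_dual_space sweedler_dual_space t x y] x y
      by (simp add: dual_map_def pure_tensor_in)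
  qed
  have lin: "linear_map (tensor G G) ground (dual_map (tensor G G) \<mu> f)"
    using J(1) linear_\<mu>
    by (auto simp: linear_map_def dual_map_def tensor_add tensor_scale image_subset_iff
        simp del: plus_fun_apply)
  have td: "tensor_to_dual G G t \<in> vecs (dual (tensor G G))"
    by (rule linear_map_in[OF linear_map_tensor_to_dual[OF sweedler_dual_space sweedler_dual_space] t])
  \<comment> \<open>Both sides are linear on \<open>G \<otimes> G\<close> and agree on pure tensors;
    off the carrier both are zero by convention.\<close>
  have "dual_map (tensor G G) \<mu> f = tensor_to_dual G G t"
  proof
    fix s
    show "dual_map (tensor G G) \<mu> f s = tensor_to_dual G G t s"
    proof (cases "s \<in> vecs (tensor G G)")
      case True
      show ?thesis
        by (rule tensor_linear_unique[OF lin _ eq True]) (use td in \<open>simp add: dual_def\<close>)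
    next
      case False
      then show ?thesis by (simp add: dual_map_def tensor_to_dual_def)
    qed
  qed
  with t show ?thesis by blast
qed

section \<open>The comultiplication and the axioms of a Hom-coalgebra\<close>

lemma sweedler_comult_in: "f \<in> vecs S \<Longrightarrow> \<Delta> f \<in> vecs (tensor S S)"
  unfolding sweedler_comult_def by (rule inv_into_into[OF dual_map_\<mu>_in])

text \<open>\<open>inv_into\<close> returns a true preimage because one exists by
  \<open>dual_map_\<mu>_in\<close>. Together with \<open>sweedler_comult_in\<close>, this is how
  \<open>\<Delta>\<close> is accessed from here on.\<close>

lemma sweedler_comult_eval:
  assumes f: "f \<in> vecs S" and x: "x \<in> vecs G" and y: "y \<in> vecs G"
  shows "\<Delta> f (\<lambda>g h. g x * h y) = f (m x y)"
proof -
  have "tensor_to_dual G G (\<Delta> f) = dual_map (tensor G G) \<mu> f"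
    unfolding sweedler_comult_def by (rule f_inv_into_f[OF dual_map_\<mu>_in[OF f]])
  then show ?thesis
    using tensor_to_dual_pure_tensor[OF sweedler_dual_space sweedler_dual_space sweedler_comult_in[OF f] x y] x y
    by (simp add: dual_map_def pure_tensor_in)
qed

text \<open>A chosen preimage is not linear by construction; linearity follows because both sides
  take the same values at pairs of points.\<close>

lemma linear_sweedler_comult: "linear_map S (tensor S S) \<Delta>"
  unfolding linear_map_def
proof (intro conjI ballI allI)
  show "\<Delta> ` vecs S \<subseteq> vecs (tensor S S)" using sweedler_comult_in by blast
next
  fix f g assume f: "f \<in> vecs S" and g: "g \<in> vecs S"
  have fg: "f + g \<in> vecs S" using vspace_add[OF vspace_sweedler_dual f g] .
  show "\<Delta> (f + g) = \<Delta> f + \<Delta> g"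
    by (rule tensor_sweedler_dual_eqI)
      (simp_all add: sweedler_comult_in sweedler_comult_eval f g fg
        tensor_add[OF sweedler_comult_in sweedler_comult_in])
next
  fix c f assume f: "f \<in> vecs S"
  have cf: "fscale c f \<in> vecs S" using vspace_scale[OF vspace_sweedler_dual f] by simp
  have "\<Delta> (fscale c f) = fscale c (\<Delta> f)"
  proof (rule tensor_sweedler_dual_eqI)
    show "fscale c (\<Delta> f) \<in> vecs (tensor S S)" by (rule tensor_scale[OF sweedler_comult_in[OF f]])
    show "\<Delta> (fscale c f) (\<lambda>f g. f x * g y) = fscale c (\<Delta> f) (\<lambda>f g. f x * g y)"
      if "x \<in> vecs G" "y \<in> vecs G" for x y
      unfolding sweedler_comult_eval[OF cf that]
      by (simp add: fscale_def sweedler_comult_eval[OF f that])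
  qed (rule sweedler_comult_in[OF cf])
  then show "\<Delta> (scl S c f) = scl (tensor S S) c (\<Delta> f)" by simp
qed

lemma linear_map_point: "x \<in> vecs G \<Longrightarrow> linear_map S ground (\<lambda>f. f x)"
  using separating_sweedler_dual by (simp add: separating_def point_evaluations_def)

lemma linear_map_point2:
  "x \<in> vecs G \<Longrightarrow> y \<in> vecs G \<Longrightarrow> linear_map (tensor S S) ground (\<lambda>t. t (\<lambda>f g. f x * g y))"
  by (simp add: linear_map_def fscale_def)

text \<open>At \<open>x\<close> and \<open>y\<close> the sides become
  \<open>f (\<alpha> (m x y))\<close> and \<open>f (m (\<alpha> x) (\<alpha> y))\<close>, which
  agree since \<alpha> is multiplicative.\<close>

lemma sweedler_comult_\<beta>:
  assumes f: "f \<in> vecs S"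
  shows "\<Delta> (\<beta> f) = tensor_map S S \<beta> \<beta> (\<Delta> f)"
proof (rule tensor_sweedler_dual_eqI)
  show "\<Delta> (\<beta> f) \<in> vecs (tensor S S)" by (rule sweedler_comult_in[OF dual_map_\<alpha>_in[OF f]])
  show "tensor_map S S \<beta> \<beta> (\<Delta> f) \<in> vecs (tensor S S)"
    by (rule linear_map_in[OF linear_map_tensor_map[OF linear_\<beta> linear_\<beta>] sweedler_comult_in[OF f]])
  fix x y assume x: "x \<in> vecs G" and y: "y \<in> vecs G"
  have "tensor_map S S \<beta> \<beta> (\<Delta> f) (\<lambda>f g. f x * g y) = \<Delta> f (\<lambda>f g. \<beta> f x * \<beta> g y)"
    using bilinear_map_tensor_form[OF linear_map_point[OF x] linear_map_point[OF y]]
    by (simp add: tensor_map_def)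
  also have "\<dots> = \<Delta> f (\<lambda>f g. f (\<alpha> x) * g (\<alpha> y))" using x y by (simp add: dual_map_def)
  also have "\<dots> = f (\<alpha> (m x y))" using f x y by (simp add: sweedler_comult_eval \<alpha>_in \<alpha>_mult)
  also have "\<dots> = \<Delta> (\<beta> f) (\<lambda>f g. f x * g y)"
    unfolding sweedler_comult_eval[OF dual_map_\<alpha>_in[OF f] x y]
    using x y by (simp add: dual_map_def mult_in)
  finally show "\<Delta> (\<beta> f) (\<lambda>f g. f x * g y) = tensor_map S S \<beta> \<beta> (\<Delta> f) (\<lambda>f g. f x * g y)" by simp
qed

text \<open>At \<open>x\<close>, \<open>y\<close>, \<open>z\<close> the sides become
  \<open>f (m (\<alpha> x) (m y z))\<close> and \<open>f (m (m x y) (\<alpha> z))\<close>, so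
  Hom-associativity of \<open>G\<close> equates them.\<close>

lemma sweedler_comult_hom_coassoc:
  assumes f: "f \<in> vecs S"
  shows "tensor_map S (tensor S S) \<beta> \<Delta> (\<Delta> f) =
    tensor_assoc S S S (tensor_map (tensor S S) S \<Delta> \<beta> (\<Delta> f))"
    (is "?L = tensor_assoc S S S ?R")
proof (rule tensor3_sweedler_dual_eqI)
  note vS = vspace_sweedler_dual
  note \<Delta>f = sweedler_comult_in[OF f]
  show "?L \<in> vecs (tensor S (tensor S S))"
    by (rule linear_map_in[OF linear_map_tensor_map[OF linear_\<beta> linear_sweedler_comult] \<Delta>f])
  have R: "?R \<in> vecs (tensor (tensor S S) S)"
    by (rule linear_map_in[OF linear_map_tensor_map[OF linear_sweedler_comult linear_\<beta>] \<Delta>f])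
  show "tensor_assoc S S S ?R \<in> vecs (tensor S (tensor S S))"
    by (rule linear_map_in[OF linear_map_tensor_assoc[OF vS vS] R])
  fix x y z assume x: "x \<in> vecs G" and y: "y \<in> vecs G" and z: "z \<in> vecs G"
  let ?b = "\<lambda>f u. f x * u (\<lambda>g h. g y * h z)"
  have b: "bilinear_map S (tensor S S) ground ?b"
    by (rule bilinear_map_tensor_form[OF linear_map_point[OF x] linear_map_point2[OF y z]])
  have "?L ?b = \<Delta> f (\<lambda>g h. \<beta> g x * \<Delta> h (\<lambda>g h. g y * h z))"
    using b by (simp add: tensor_map_def)
  \<comment> \<open>The value of \<open>\<Delta> h\<close> is known only for \<open>h\<close> in
    \<open>S\<close>, so the form is rewritten by congruence on the carriers.\<close>
  also have "\<dots> = \<Delta> f (\<lambda>g h. g (\<alpha> x) * h (m y z))"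
    by (rule tensor_form_cong[OF \<Delta>f vS vS]) (use x y z in \<open>simp add: dual_map_def sweedler_comult_eval\<close>)
  also have "\<dots> = f (m (\<alpha> x) (m y z))"
    using x y z by (simp add: sweedler_comult_eval[OF f] \<alpha>_in mult_in)
  finally have L: "?L ?b = f (m (\<alpha> x) (m y z))" .
  \<comment> \<open>The associator turns \<open>?b\<close> into a form with the scalar
    \<open>h z\<close> inside the argument of \<open>u\<close>; taking it out gives
    \<open>?c\<close>, which suits the left bracketing.\<close>
  let ?c = "\<lambda>u h. u (\<lambda>f g. f x * g y) * h z"
  have c: "bilinear_map (tensor S S) S ground ?c"
    by (rule bilinear_map_tensor_form[OF linear_map_point2[OF x y] linear_map_point[OF z]])
  have yz: "bilinear_map S S ground (\<lambda>g h. g y * h z)"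
    by (rule bilinear_map_tensor_form[OF linear_map_point[OF y] linear_map_point[OF z]])
  have xy: "bilinear_map S S ground (\<lambda>g h. g x * h y)"
    by (rule bilinear_map_tensor_form[OF linear_map_point[OF x] linear_map_point[OF y]])
  have "tensor_assoc S S S ?R ?b = ?R (\<lambda>u h. u (\<lambda>f g. f x * (g y * h z)))"
    using b yz by (simp add: tensor_assoc_def pure_tensor_def)
  also have "\<dots> = ?R ?c"
  proof (rule tensor_form_cong[OF R vspace_tensor vS])
    fix u h assume u: "u \<in> vecs (tensor S S)" and h: "h \<in> vecs S"
    have xyh: "bilinear_map S S ground (\<lambda>f g. f x * (g y * h z))"
      using linear_map_point[OF y]
      by (intro bilinear_map_tensor_form[OF linear_map_point[OF x]])
        (simp add: linear_map_def algebra_simps)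
    have "u (\<lambda>f g. f x * (g y * h z)) = h z * u (\<lambda>f g. f x * g y)"
      by (rule tensor_form_scale[OF u xy _ xyh]) simp
    then show "u (\<lambda>f g. f x * (g y * h z)) = u (\<lambda>f g. f x * g y) * h z" by simp
  qed
  also have "\<dots> = \<Delta> f (\<lambda>g h. \<Delta> g (\<lambda>f g. f x * g y) * \<beta> h z)"
    using c by (simp add: tensor_map_def)
  also have "\<dots> = \<Delta> f (\<lambda>g h. g (m x y) * h (\<alpha> z))"
    by (rule tensor_form_cong[OF \<Delta>f vS vS]) (use x y z in \<open>simp add: dual_map_def sweedler_comult_eval\<close>)
  also have "\<dots> = f (m (m x y) (\<alpha> z))"
    using x y z by (simp add: sweedler_comult_eval[OF f] \<alpha>_in mult_in)
  finally show "?L ?b = tensor_assoc S S S ?R ?b" using L hom_assoc[OF x y z] by simp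
qed

lemma hom_coalgebra_sweedler_dual: "hom_coalgebra S \<Delta> \<beta>"
  unfolding hom_coalgebra_def
  using vspace_sweedler_dual linear_sweedler_comult linear_\<beta> sweedler_comult_hom_coassoc
    sweedler_comult_\<beta> by blast

end

text \<open>Injectivity and the first inclusion give every transposed functional a unique preimage,
  so the \<open>inv_into\<close> in \<open>sweedler_comult\<close> really yields the restriction of
  the dual of \<mu>.\<close>

theorem theorem2:
  fixes G :: "('k::field_char_0, 'g::ab_group_add) vs"
    and \<mu> :: "(('g \<Rightarrow> 'g \<Rightarrow> 'k) \<Rightarrow> 'k) \<Rightarrow> 'g"
    and \<alpha> :: "'g \<Rightarrow> 'g"
  assumes "hom_algebra G \<mu> \<alpha>"
  shows "let S = sweedler_dual G \<mu> \<alpha> in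
    inj_on (tensor_to_dual G G) (vecs (tensor S S)) \<and>
    dual_map (tensor G G) \<mu> ` vecs S \<subseteq> tensor_to_dual G G ` vecs (tensor S S) \<and>
    dual_map G \<alpha> ` vecs S \<subseteq> vecs S \<and>
    hom_coalgebra S (sweedler_comult G \<mu> \<alpha>) (dual_map G \<alpha>)"
  unfolding Let_def
  using inj_on_tensor_to_dual[OF assms] dual_map_\<mu>_in[OF assms] dual_map_\<alpha>_in[OF assms]
    hom_coalgebra_sweedler_dual[OF assms]
  by blast

end
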